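(* Let $g(s)=\frac{1}{1+G(s)}$ be the sensitivity function of a linear feedback system with open-loop (forward path) transfer function $G$. Suppose: (i) $g$ is non-analytic in the open right half plane; (ii) the zeros of $g$ in the open right half plane (its non-minimum phase zeros) are $\alpha_1,\dots,\alpha_M$; (iii) the poles of $g$ in the open right half plane are $\beta_1,\dots,\beta_N$. Then for every point $\sigma_k+j\eta_k$ (with $\sigma_k>0$, $\eta_k\in\mathbb{R}$) of the open right half plane that is neither a zero nor a pole of $g$, $$\int_{-\infty}^{\infty}\log|g(j\omega)|\,\frac{\sigma_k}{\sigma_k^2+(\omega-\eta_k)^2}\,d\omega=-\pi\left(-\log|g(\sigma_k+j\eta_k)|+\sum_{1\le i\le M}\log\left|\frac{\sigma_k+j\eta_k-\alpha_i}{\sigma_k+j\eta_k+\overline{\alpha}_i}\right|+\sum_{1\le i\le N}\log\left|\frac{\sigma_k+j\eta_k+\overline{\beta}_i}{\sigma_k+j\eta_k-\beta_i}\right|\right).$$ Moreover, suppose that $G$ has non-minimum phase zeros $\varsigma_1,\dots,\varsigma_L$ (zeros in the open right half plane). Then for each $1\le k\le L$, with $\sigma_k+j\eta_k=\varsigma_k$, $$\int_{-\infty}^{\infty}\log|g(j\omega)|\,\frac{\sigma_k}{\sigma_k^2+(\omega-\eta_k)^2}\,d\omega=-\pi\left(\sum_{1\le i\le M}\log\left|\frac{\sigma_k+j\eta_k-\alpha_i}{\sigma_k+j\eta_k+\overline{\alpha}_i}\right|+\sum_{1\le i\le N}\log\left|\frac{\sigma_k+j\eta_k+\overline{\beta}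_i}{\sigma_k+j\eta_k-\beta_i}\right|\right).$$
   Context: Here $j$ is the imaginary unit, $\log$ of a positive real is the natural logarithm, and the open right half plane (RHP) is $\{s\in\mathbb{C}:\operatorname{Re}s>0\}$. The linear feedback system is a unity feedback loop with plant transfer function $G_p(s)$, controller transfer function $G_c(s)$ and open-loop (forward path) transfer function $G(s)=G_c(s)G_p(s)$. Transfer functions are quotients of polynomials with real coefficients, possibly multiplied by a dead-time factor: $G(s)=\frac{Q(s)}{P(s)}e^{-t_d s}$ with real polynomials $P,Q$, $P\not\equiv0$, and $t_d\ge 0$; no restriction is placed on the relative degree. It is assumed that $1+G\not\equiv 0$, and $g=1/(1+G)$ is regarded as a meromorphic function on $\mathbb{C}$. The lists $\alpha_1,\dots,\alpha_M$ and $\beta_1,\dots,\beta_N$ are finite and complete lists of the RHP zeros and RHP poles of $g$, repeated according to multiplicity. *)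

theory Defs
  imports "HOL-Complex_Analysis.Complex_Analysis"
begin

text \<open>
  All functions below are meromorphic functions on the complex plane, represented as total
  functions. Since \<open>x / 0 = 0\<close>, pointwise arithmetic produces arbitrary values at isolated points
  (common zeros of \<open>P\<close> and \<open>Q\<close>, pole-zero cancellations in a product, poles of \<open>G\<close> in
  \<open>1 / (1 + G)\<close>). Applying \<^const>\<open>remove_sings\<close> replaces them by the value of the meromorphic
  function, i.e. the limit, wherever that exists; poles get the value 0.
\<close>

definition transfer_function :: "(complex \<Rightarrow> complex) \<Rightarrow> bool" where
  "transfer_function G \<longleftrightarrow>
     (\<exists>(Q :: real poly) (P :: real poly) (td :: real). P \<noteq> 0 \<and> td \<ge> 0 \<and>
        G = remove_sings (\<lambda>s. poly (map_poly of_real Q) s / poly (map_poly of_real P) s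
                               * exp (- of_real td * s)))"

definition open_loop :: "(complex \<Rightarrow> complex) \<Rightarrow> (complex \<Rightarrow> complex) \<Rightarrow> complex \<Rightarrow> complex" where
  "open_loop Gc Gp = remove_sings (\<lambda>s. Gc s * Gp s)"

definition sensitivity :: "(complex \<Rightarrow> complex) \<Rightarrow> complex \<Rightarrow> complex" where
  "sensitivity G = remove_sings (\<lambda>s. 1 / (1 + G s))"

definition rhp :: "complex set" where
  "rhp = {s. Re s > 0}"

text \<open>
  \<open>rhp_zeros f as\<close>: the list \<open>as\<close> contains exactly the zeros of \<open>f\<close> in the open right half plane,
  each as often as its multiplicity. \<open>rhp_poles\<close> is the analogue for poles, where
  \<^const>\<open>zorder\<close> is minus the multiplicity.
\<close>

definition rhp_zeros :: "(complex \<Rightarrow> complex) \<Rightarrow> complex list \<Rightarrow> bool" where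
  "rhp_zeros f as \<longleftrightarrow>
     (\<forall>s. count_list as s = (if s \<in> rhp \<and> isolated_zero f s then nat (zorder f s) else 0))"

definition rhp_poles :: "(complex \<Rightarrow> complex) \<Rightarrow> complex list \<Rightarrow> bool" where
  "rhp_poles f bs \<longleftrightarrow>
     (\<forall>s. count_list bs s = (if s \<in> rhp \<and> is_pole f s then nat (- zorder f s) else 0))"

end

theory Submission
  imports Defs "HOL-Computational_Algebra.Fundamental_Theorem_Algebra" "HOL-Real_Asymp.Real_Asymp"
begin

text \<open>
  Write \<open>G = (Q / P) exp (- t s)\<close> with \<open>P\<close>, \<open>Q\<close> without common root, so that \<open>g = P / F\<close> with the
  entire functions \<open>P\<close> and \<open>F = P + Q exp (- t s)\<close>, both of polynomial growth on the right half plane.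
  For such a function the finitely many right half plane zeros \<open>a\<close> can be reflected to \<open>- cnj a\<close>
  without changing the modulus on the imaginary axis, and the Poisson formula for the resulting
  zero-free function yields the Blaschke terms; subtracting the formulas for \<open>P\<close> and \<open>F\<close> gives the
  theorem, and at a zero of \<open>G\<close> one has \<open>g = 1\<close>.

  The Poisson formula allows infinitely many zeros on the imaginary axis. By a Cayley transform it
  becomes the mean value formula for \<open>ln |H|\<close> on the unit circle, \<open>H\<close> bounded by 1 and zero-free in
  the disc and analytic at the boundary except at 1. It is obtained from circles of radius \<open>r < 1\<close>:
  away from 1 one passes to the limit by dominated convergence, and near 1 the mass of \<open>- ln |H|\<close>
  is controlled, via the Poisson kernel, by the values of \<open>- ln |H|\<close> on the radius ending at 1.
\<close>

subsection \<open>Boundary values of zero-free functions on the disc\<close>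

text \<open>Cauchy's formula at \<open>p\<close>, applied not to \<open>L\<close> but to
  \<open>f\<close>, which carries the extra factor
  \<open>(r\<^sup>2 - |p|\<^sup>2) / (r\<^sup>2 - cnj p * w)\<close>. This factor is holomorphic on
  the closed disc and equals 1 at \<open>p\<close>. On the circle
  \<open>r\<^sup>2 = w * cnj w\<close>, so it turns the Cauchy kernel into the Poisson
  kernel.\<close>

lemma poisson_integral_circle:
  fixes L :: "complex \<Rightarrow> complex"
  assumes L: "L holomorphic_on ball 0 1" and r: "r < 1" and p: "cmod p < r"
  shows "((\<lambda>t. of_real ((r\<^sup>2 - (cmod p)\<^sup>2) / (cmod (of_real r * cis t - p))\<^sup>2) * L (of_real r * cis t))
           has_integral 2 * pi * L p) {0..2 * pi}"
proof -
  have r0: "0 < r" using p by (meson norm_ge_zero le_less_trans)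
  define k where "k w = of_real (r\<^sup>2) - cnj p * w" for w
  define f where "f w = L w * of_real (r\<^sup>2 - (cmod p)\<^sup>2) / k w" for w
  have k: "k w \<noteq> 0" if "w \<in> cball 0 r" for w
  proof -
    have "cmod (cnj p * w) \<le> cmod p * r"
      using that by (simp add: norm_mult mult_left_mono)
    also have "\<dots> < r\<^sup>2" using p r0 by (simp add: power2_eq_square)
    finally have "cmod (cnj p * w) < cmod (of_real (r\<^sup>2))" by (simp add: norm_power)
    then show ?thesis unfolding k_def by auto
  qed
  have sub: "cball 0 r \<subseteq> ball (0::complex) 1" using r by auto
  have "f holomorphic_on cball 0 r"
    unfolding f_def using k
    by (intro holomorphic_intros holomorphic_on_subset[OF L sub]) (auto simp: k_def intro!: holomorphic_intros)
  then have "((\<lambda>u. f u / (u - p)) has_contour_integral (2 * of_real pi * \<i> * f p)) (circlepath 0 r)"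
    using p by (intro Cauchy_integral_circlepath)
      (auto intro: holomorphic_on_imp_continuous_on holomorphic_on_subset)
  moreover have "f p = L p"
  proof -
    have "of_real (r\<^sup>2 - (cmod p)\<^sup>2) = k p"
      unfolding k_def of_real_diff complex_norm_square by (simp add: mult.commute)
    then show ?thesis using k[of p] p by (simp add: f_def)
  qed
  ultimately have "((\<lambda>t. f (r * cis t) / (r * cis t - p) * r * \<i> * cis t)
      has_integral 2 * of_real pi * \<i> * L p) {0..2 * pi}"
    unfolding circlepath_def by (simp add: has_contour_integral_part_circlepath_iff)
  from has_integral_mult_right[OF this, of "-\<i>"]
  have "((\<lambda>t. - \<i> * (f (r * cis t) / (r * cis t - p) * r * \<i> * cis t))
      has_integral 2 * of_real pi * L p) {0..2 * pi}"
    by (simp add: algebra_simps)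
  moreover have "- \<i> * (f (r * cis t) / (r * cis t - p) * r * \<i> * cis t) =
     of_real ((r\<^sup>2 - (cmod p)\<^sup>2) / (cmod (of_real r * cis t - p))\<^sup>2) * L (of_real r * cis t)" for t
  proof -
    define w where "w = of_real r * cis t"
    have w: "cmod w = r" using r0 by (simp add: w_def norm_mult)
    then have kw: "k w \<noteq> 0" using k by auto
    have "k w = w * cnj w - cnj p * w"
      unfolding k_def using complex_norm_square[of w] w by simp
    then have kw': "k w = w * cnj (w - p)" by (simp add: algebra_simps)
    have wp: "w \<noteq> p" using w p by auto
    have "w \<noteq> 0" using kw kw' by auto
    have "- \<i> * (X * \<i>) = X" for X by (simp add: mult.commute[of X \<i>])
    then have "- \<i> * (f w / (w - p) * w * \<i>) = f w / (w - p) * w" .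
    also have "\<dots> = L w * of_real (r\<^sup>2 - (cmod p)\<^sup>2) / ((w - p) * cnj (w - p))"
      using wp \<open>w \<noteq> 0\<close> unfolding f_def kw' by (simp add: divide_simps)
    also have "(w - p) * cnj (w - p) = of_real ((cmod (w - p))\<^sup>2)"
      by (metis complex_norm_square of_real_power)
    finally have "- \<i> * (f w / (w - p) * w * \<i>) = of_real ((r\<^sup>2 - (cmod p)\<^sup>2) / (cmod (w - p))\<^sup>2) * L w"
      by simp
    then show ?thesis by (simp add: w_def mult_ac)
  qed
  ultimately show ?thesis by simp
qed

section \<open>Integrable majorants near boundary zeros\<close>

text \<open>The antiderivative \<open>(t - a) * ln |t - a| - t\<close> stays continuous at
  \<open>a\<close>, because \<open>x * ln |x|\<close> tends to 0. These functions are the majorants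
  for \<open>- ln |H|\<close> near zeros of \<open>H\<close> on the unit circle.\<close>

lemma abs_ln_integrable_on:
  fixes a c d :: real
  shows "(\<lambda>t. \<bar>ln \<bar>t - a\<bar>\<bar>) integrable_on {c..d}"
proof (cases "c \<le> d")
  case True
  define F where "F t = (t - a) * ln \<bar>t - a\<bar> - t" for t :: real
  have xlnx: "((\<lambda>x::real. x * ln \<bar>x\<bar>) \<longlongrightarrow> 0) (at 0)"
  proof -
    have "((\<lambda>x::real. x * ln \<bar>x\<bar>) \<longlongrightarrow> 0) (at_right 0)" by real_asymp
    moreover have "((\<lambda>x::real. x * ln \<bar>x\<bar>) \<longlongrightarrow> 0) (at_left 0)" by real_asymp
    ultimately show ?thesis by (simp add: filterlim_split_at)
  qed
  have cont: "isCont F t" for t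
  proof (cases "t = a")
    case False
    then show ?thesis unfolding F_def by (intro continuous_intros) auto
  next
    case True
    have "((\<lambda>t. (t - a) * ln \<bar>t - a\<bar>) \<longlongrightarrow> 0) (at a)"
      using LIM_offset[OF xlnx, of "-a"] by simp
    then have "((\<lambda>t. (t - a) * ln \<bar>t - a\<bar> - t) \<longlongrightarrow> 0 - a) (at a)"
      by (intro tendsto_intros)
    then show ?thesis unfolding True isCont_def F_def by simp
  qed
  have der: "(F has_vector_derivative ln \<bar>t - a\<bar>) (at t)" if "t \<noteq> a" for t
  proof -
    have "((\<lambda>t. (t - a) * ln (t - a) - t) has_real_derivative ln \<bar>t - a\<bar>) (at t)" if "t > a"
      using that by (auto intro!: derivative_eq_intros)
    moreover have "((\<lambda>t. (t - a) * ln (a - t) - t) has_real_derivative ln \<bar>t - a\<bar>) (at t)" if "t < a"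
      using that by (auto intro!: derivative_eq_intros simp: divide_simps)
    moreover have "F = (\<lambda>t. (t - a) * ln (t - a) - t)" "F = (\<lambda>t. (t - a) * ln (a - t) - t)"
      using ln_minus[of "t - a" for t] by (auto simp: F_def fun_eq_iff abs_if)
    ultimately show ?thesis using that
      by (metis has_real_derivative_iff_has_vector_derivative linorder_neqE_linordered_idom)
  qed
  have "((\<lambda>t. ln \<bar>t - a\<bar>) has_integral (F d - F c)) {c..d}"
    by (rule fundamental_theorem_of_calculus_interior_strong[of "{a}"])
       (use True der in \<open>auto intro!: continuous_at_imp_continuous_on cont\<close>)
  then have int: "(\<lambda>t. ln \<bar>t - a\<bar>) integrable_on {c..d}" by blast
  \<comment> \<open>An integrable function below an absolutely integrable one is itself absolutely
    integrable; the bound used is \<open>ln y \<le> y\<close>, with \<open>ln 0 = 0\<close> at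
    \<open>t = a\<close>.\<close>
  have "(\<lambda>t. ln \<bar>t - a\<bar>) absolutely_integrable_on {c..d}"
  proof (rule absolutely_integrable_absolutely_integrable_ubound[OF int])
    show "(\<lambda>t. \<bar>t - a\<bar>) absolutely_integrable_on {c..d}"
      by (intro absolutely_integrable_continuous_real continuous_intros)
    show "ln \<bar>t - a\<bar> \<le> \<bar>t - a\<bar>" for t
      using ln_le_minus_one[of "\<bar>t - a\<bar>"] by (cases "t = a") auto
  qed
  then show ?thesis unfolding absolutely_integrable_on_def by simp
qed auto

text \<open>Rotating by \<open>cis (- t)\<close> makes the first term real, so the imaginary part
  that remains is \<open>sin (t - s)\<close>, whatever \<open>r\<close> is. The factor 1/2 is
  \<open>cos (pi / 3)\<close>, a lower bound for the cosine on [0, 1]. Uniformity in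
  \<open>r\<close> is what the domination argument needs.\<close>

lemma cmod_scaled_cis_diff_ge:
  assumes "\<bar>t - s\<bar> \<le> 1"
  shows "\<bar>t - s\<bar> / 2 \<le> cmod (of_real r * cis t - cis s)"
proof -
  have "\<bar>sin (t - s)\<bar> = \<bar>Im (cis (- t) * (of_real r * cis t - cis s))\<bar>"
    by (simp add: sin_diff algebra_simps)
  also have "\<dots> \<le> cmod (of_real r * cis t - cis s)"
    using abs_Im_le_cmod[of "cis (- t) * (of_real r * cis t - cis s)"] by (simp add: norm_mult)
  finally have 1: "\<bar>sin (t - s)\<bar> \<le> cmod (of_real r * cis t - cis s)" .
  have "\<bar>x\<bar> / 2 \<le> \<bar>sin x\<bar>" if "\<bar>x\<bar> \<le> 1" for x :: real
  proof -
    have "y / 2 \<le> sin y" if y: "0 < y" "y \<le> 1" for y :: real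
    proof -
      obtain z where z: "0 < z" "z < y" "sin y - sin 0 = (y - 0) * cos z"
        using MVT2[of 0 y sin cos] y by (auto intro: derivative_eq_intros)
      have "cos (pi / 3) \<le> cos z"
        using z y pi_gt3 by (intro cos_monotone_0_pi_le) auto
      then show ?thesis using z y by (simp add: cos_60)
    qed
    from this[of "\<bar>x\<bar>"] that show ?thesis by (cases "x = 0") (auto simp: abs_if split: if_splits)
  qed
  with 1 assms show ?thesis by (meson order_trans)
qed

text \<open>Split off the zero at \<open>p\<close>, of order \<open>n\<close> (possibly 0): the
  cofactor has no zero on a small closed ball, so its modulus attains a positive minimum there. The
  point \<open>w0\<close> rules out that \<open>H\<close> vanishes identically.\<close>

lemma holomorphic_local_lower_bound:
  assumes "H holomorphic_on ball p e" "e > 0" "w0 \<in> ball p e" "H w0 \<noteq> 0"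
  obtains d c n where "d > 0" "c > 0" "\<And>w. cmod (w - p) < d \<Longrightarrow> c * cmod (w - p) ^ n \<le> cmod (H w)"
proof -
  obtain r where r: "r > 0" "cball p r \<subseteq> ball p e" "zor_poly H p holomorphic_on cball p r"
     "\<And>w. w \<in> cball p r \<Longrightarrow> H w = zor_poly H p w * (w - p) ^ nat (zorder H p) \<and> zor_poly H p w \<noteq> 0"
    using zorder_exist_zero[of H "ball p e" p] assms by (metis centre_in_ball connected_ball open_ball)
  have "continuous_on (cball p r) (\<lambda>w. cmod (zor_poly H p w))"
    using r(3) by (intro continuous_intros holomorphic_on_imp_continuous_on)
  then obtain w1 where w1: "w1 \<in> cball p r" "\<And>w. w \<in> cball p r \<Longrightarrow> cmod (zor_poly H p w1) \<le> cmod (zor_poly H p w)"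
    using continuous_attains_inf[of "cball p r"] r(1) by (metis (no_types, lifting) compact_cball cball_eq_empty not_less_iff_gr_or_eq)
  show ?thesis
  proof (rule that[of r "cmod (zor_poly H p w1)" "nat (zorder H p)"])
    show "cmod (zor_poly H p w1) * cmod (w - p) ^ nat (zorder H p) \<le> cmod (H w)" if "cmod (w - p) < r" for w
    proof -
      have w: "w \<in> cball p r" using that by (simp add: dist_norm norm_minus_commute)
      then have "cmod (H w) = cmod (zor_poly H p w) * cmod (w - p) ^ nat (zorder H p)"
        using r(4)[OF w] by (metis norm_mult norm_power)
      then show ?thesis using w1(2)[OF w] by (simp add: mult_right_mono)
    qed
  qed (use r w1 in auto)
qed

lemma cmod_cis_diff_le: "cmod (cis s - cis t) \<le> \<bar>s - t\<bar>"
proof -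
  have "cis s - cis t = cis t * (exp (\<i> * of_real (s - t)) - 1)"
    by (simp add: cis_conv_exp algebra_simps flip: exp_add)
  then have "cmod (cis s - cis t) = 2 * \<bar>sin ((s - t) / 2)\<bar>"
    using dist_exp_i_1[of "s - t"] by (simp add: norm_mult)
  also have "\<dots> \<le> \<bar>s - t\<bar>" using abs_sin_x_le_abs_x[of "(s - t) / 2"] by simp
  finally show ?thesis .
qed

text \<open>Near \<open>cis s\<close> the function decays at most like a power of the distance to
  \<open>cis s\<close>, and this distance is at least \<open>|t - s| / 2\<close> on every circle.
  Hence one majorant serves all radii near 1, including \<open>r = 1\<close>, and
  \<open>t = s\<close> is the only angle nearby at which \<open>H\<close> can vanish.\<close>

lemma neg_ln_cmod_local_bound:
  assumes H: "H analytic_on cball 0 1 - {1}" and nz: "\<And>z. z \<in> ball 0 1 \<Longrightarrow> H z \<noteq> 0"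
    and s: "cis s \<noteq> 1"
  obtains d and c :: real and n :: nat where "d > 0"
    "\<And>t r. \<lbrakk>\<bar>t - s\<bar> < d; 1 - d < r; r \<le> 1; t \<noteq> s\<rbrakk> \<Longrightarrow>
       H (of_real r * cis t) \<noteq> 0 \<and> - ln (cmod (H (of_real r * cis t))) \<le> \<bar>c\<bar> + n * \<bar>ln \<bar>t - s\<bar>\<bar>"
proof -
  have "cis s \<in> cball 0 1 - {1}" using s by simp
  then obtain e where e: "e > 0" "H holomorphic_on ball (cis s) e"
    using H unfolding analytic_on_def by blast
  \<comment> \<open>A point inside the open disc and within \<open>e\<close> of
    \<open>cis s\<close>; there \<open>H\<close> is nonzero, so \<open>H\<close> is not identically
    zero near \<open>cis s\<close>.\<close>
  define w0 where "w0 = of_real (1 - min e 1 / 2) * cis s"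
  have "dist (cis s) w0 = min e 1 / 2"
  proof -
    have "cis s - w0 = of_real (min e 1 / 2) * cis s" by (simp add: w0_def algebra_simps)
    then show ?thesis using e(1) by (simp add: dist_norm norm_mult del: of_real_divide)
  qed
  then have w0: "w0 \<in> ball (cis s) e" using e(1) by auto
  have "cmod w0 < 1" using e(1) by (simp add: w0_def norm_mult del: of_real_diff of_real_divide)
  then have "H w0 \<noteq> 0" using nz by simp
  from holomorphic_local_lower_bound[OF e(2,1) w0 this] obtain d1 c n where
    d1: "d1 > 0" "c > 0" "\<And>w. cmod (w - cis s) < d1 \<Longrightarrow> c * cmod (w - cis s) ^ n \<le> cmod (H w)"
    by metis
  show ?thesis
  proof (rule that[of "min 1 (d1 / 2)" "ln (c / 2 ^ n)" n])
    fix t r assume *: "\<bar>t - s\<bar> < min 1 (d1 / 2)" "1 - min 1 (d1 / 2) < r" "r \<le> 1" "t \<noteq> s"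
    let ?w = "of_real r * cis t"
    have "?w - cis s = of_real (r - 1) * cis t + (cis t - cis s)" by (simp add: algebra_simps)
    then have "cmod (?w - cis s) \<le> cmod (of_real (r - 1) * cis t) + cmod (cis t - cis s)"
      using norm_triangle_ineq by metis
    also have "\<dots> \<le> \<bar>r - 1\<bar> + \<bar>t - s\<bar>"
      using cmod_cis_diff_le[of t s] by (simp add: norm_mult del: of_real_diff)
    also have "\<dots> < d1" using * by linarith
    finally have le: "c * cmod (?w - cis s) ^ n \<le> cmod (H ?w)" using d1 by blast
    have "(\<bar>t - s\<bar> / 2) ^ n \<le> cmod (?w - cis s) ^ n"
      using * by (intro power_mono cmod_scaled_cis_diff_ge) auto
    then have "c * (\<bar>t - s\<bar> / 2) ^ n \<le> cmod (H ?w)"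
      using le d1(2) by (meson mult_left_mono less_imp_le order_trans)
    then have le: "c / 2 ^ n * \<bar>t - s\<bar> ^ n \<le> cmod (H ?w)" by (simp add: power_divide)
    have pos: "0 < c / 2 ^ n * \<bar>t - s\<bar> ^ n" using * d1(2) by simp
    have "ln (c / 2 ^ n * \<bar>t - s\<bar> ^ n) \<le> ln (cmod (H ?w))"
      using le pos by (meson ln_mono less_le_trans)
    moreover have "ln (c / 2 ^ n * \<bar>t - s\<bar> ^ n) = ln (c / 2 ^ n) + n * ln \<bar>t - s\<bar>"
      using * d1(2) by (subst ln_mult_pos) (auto simp: ln_realpow)
    moreover have "- (n * ln \<bar>t - s\<bar>) \<le> n * \<bar>ln \<bar>t - s\<bar>\<bar>"
      using mult_left_mono[of "- ln \<bar>t - s\<bar>" "\<bar>ln \<bar>t - s\<bar>\<bar>" "real n"] by simp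
    ultimately show "H ?w \<noteq> 0 \<and> - ln (cmod (H ?w)) \<le> \<bar>ln (c / 2 ^ n)\<bar> + n * \<bar>ln \<bar>t - s\<bar>\<bar>"
      using pos le by (smt (verit) norm_zero)
  qed (use d1 in auto)
qed

lemma cis_neq_1:
  assumes "0 < t" "t < 2 * pi"
  shows "cis t \<noteq> 1"
proof
  assume "cis t = 1"
  then have "cos t = 1" by (metis cis.simps(1) one_complex.simps(1))
  then obtain n :: int where n: "t = n * 2 * pi" using cos_one_2pi_int by auto
  then have "0 < real_of_int n" "real_of_int n < 1" using assms by (simp_all add: zero_less_mult_iff)
  then have "0 < n" "n < 1" by simp_all
  then show False by linarith
qed

text \<open>By compactness finitely many local bounds cover the arc, and their sum dominates. The
  exceptional set \<open>Z\<close> consists of the centres of the cover, so it contains every angle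
  of the arc at which \<open>H\<close> vanishes on the circle.\<close>

lemma neg_ln_cmod_domination:
  assumes H: "H analytic_on cball 0 1 - {1}" and nz: "\<And>z. z \<in> ball 0 1 \<Longrightarrow> H z \<noteq> 0" and "a > 0"
  obtains Z d D where "finite Z" "d > 0" "D integrable_on {a..2 * pi - a}"
    "\<And>t r. \<lbrakk>t \<in> {a..2 * pi - a} - Z; 1 - d < r; r \<le> 1\<rbrakk> \<Longrightarrow>
       H (of_real r * cis t) \<noteq> 0 \<and> - ln (cmod (H (of_real r * cis t))) \<le> D t"
proof -
  let ?I = "{a..2 * pi - a}"
  have "\<exists>d c. \<exists>n::nat. d > 0 \<and> (\<forall>t r. \<bar>t - s\<bar> < d \<longrightarrow> 1 - d < r \<longrightarrow> r \<le> 1 \<longrightarrow> t \<noteq> s \<longrightarrow>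
       H (of_real r * cis t) \<noteq> 0 \<and> - ln (cmod (H (of_real r * cis t))) \<le> \<bar>c\<bar> + n * \<bar>ln \<bar>t - s\<bar>\<bar>)"
    if "s \<in> ?I" for s
  proof -
    have "cis s \<noteq> 1" using that \<open>a > 0\<close> by (intro cis_neq_1) auto
    from neg_ln_cmod_local_bound[OF H nz this] show ?thesis by metis
  qed
  then obtain d c and n :: "real \<Rightarrow> nat" where d: "\<And>s. s \<in> ?I \<Longrightarrow> d s > 0"
    and bd: "\<And>s t r. \<lbrakk>s \<in> ?I; \<bar>t - s\<bar> < d s; 1 - d s < r; r \<le> 1; t \<noteq> s\<rbrakk> \<Longrightarrow>
       H (of_real r * cis t) \<noteq> 0 \<and> - ln (cmod (H (of_real r * cis t))) \<le> \<bar>c s\<bar> + n s * \<bar>ln \<bar>t - s\<bar>\<bar>"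
    by metis
  obtain J where J: "J \<subseteq> ?I" "finite J" "?I \<subseteq> (\<Union>s\<in>J. ball s (d s))"
  proof (rule compactE_image[of ?I ?I "\<lambda>s. ball s (d s)"])
    show "?I \<subseteq> (\<Union>s\<in>?I. ball s (d s))" using d by force
  qed auto
  \<comment> \<open>All summands are nonnegative, thanks to the absolute values, so each local bound
    is below the sum.\<close>
  define D where "D t = (\<Sum>s\<in>J. \<bar>c s\<bar> + n s * \<bar>ln \<bar>t - s\<bar>\<bar>)" for t
  \<comment> \<open>For \<open>a > pi\<close> the arc and \<open>J\<close> may be empty; the
    inserted 1 keeps the minimum meaningful.\<close>
  define e where "e = Min (insert 1 (d ` J))"
  have e: "e > 0" "\<And>s. s \<in> J \<Longrightarrow> e \<le> d s" using J d by (auto simp: e_def)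
  show ?thesis
  proof (rule that[of J e D])
    show "D integrable_on ?I" unfolding D_def using J(2)
      by (intro integrable_sum integrable_add integrable_on_mult_right abs_ln_integrable_on) auto
    fix t r assume *: "t \<in> ?I - J" "1 - e < r" "r \<le> 1"
    then obtain s where s: "s \<in> J" "\<bar>t - s\<bar> < d s" using J(3) by (force simp: dist_real_def)
    have "H (of_real r * cis t) \<noteq> 0 \<and> - ln (cmod (H (of_real r * cis t))) \<le> \<bar>c s\<bar> + n s * \<bar>ln \<bar>t - s\<bar>\<bar>"
      using s * J(1) e(2)[OF s(1)] by (intro bd) auto
    moreover have "\<bar>c s\<bar> + n s * \<bar>ln \<bar>t - s\<bar>\<bar> \<le> D t"
      unfolding D_def using s J(2) by (intro member_le_sum) auto
    ultimately show "H (of_real r * cis t) \<noteq> 0 \<and> - ln (cmod (H (of_real r * cis t))) \<le> D t" by auto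
  qed (use J e in auto)
qed

text \<open>The point \<open>1 - a\<close> is as far from the exceptional boundary point 1 as the ends of the arc
  \<open>\<bar>t\<bar> \<le> a\<close> excised there, so the Poisson kernel of \<open>1 - a\<close> is of order \<open>1 / a\<close> on that arc.\<close>

lemma poisson_kernel_end_arc_ge:
  assumes a: "0 < a" "a < 1" and r: "1 - a < r" "r < 1"
    and t: "t \<in> {0..2 * pi}" "t \<notin> {a..2 * pi - a}"
  shows "1 \<le> 4 * a\<^sup>2 / (r\<^sup>2 - (1 - a)\<^sup>2) * ((r\<^sup>2 - (1 - a)\<^sup>2) / (cmod (of_real r * cis t - of_real (1 - a)))\<^sup>2)"
proof -
  have sq: "(1 - a)\<^sup>2 < r\<^sup>2" using a r by (intro power_strict_mono) auto
  have "cmod (cis t - 1) \<le> a"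
  proof (cases "t \<le> a")
    case True
    then show ?thesis using cmod_cis_diff_le[of t 0] t by simp
  next
    case False
    then show ?thesis using cmod_cis_diff_le[of t "2 * pi"] t by simp
  qed
  moreover have "of_real r * cis t - of_real (1 - a) = of_real r * (cis t - 1) + of_real (r - (1 - a))"
    by (simp add: algebra_simps)
  then have "cmod (of_real r * cis t - of_real (1 - a)) \<le> r * cmod (cis t - 1) + (r - (1 - a))"
    using a r norm_triangle_ineq[of "of_real r * (cis t - 1)" "of_real (r - (1 - a))"]
    by (simp add: norm_mult del: of_real_diff)
  moreover have "r * cmod (cis t - 1) \<le> cmod (cis t - 1)"
    using a r by (simp add: mult_left_le_one_le)
  ultimately have le: "cmod (of_real r * cis t - of_real (1 - a)) \<le> 2 * a" using r by linarith
  have "cmod (of_real (1 - a)) < cmod (of_real r * cis t)" using a r by (simp add: norm_mult del: of_real_diff)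
  then have pos: "0 < cmod (of_real r * cis t - of_real (1 - a))" by (metis less_irrefl right_minus_eq zero_less_norm_iff)
  have "(cmod (of_real r * cis t - of_real (1 - a)))\<^sup>2 \<le> 4 * a\<^sup>2"
    using power_mono[OF le, of 2] by (simp add: power_mult_distrib)
  then show ?thesis using sq pos by (simp add: divide_simps)
qed

text \<open>The hypothesis at 1 excludes a singular inner factor \<open>exp ((w + 1) / (w - 1))\<close>.\<close>

lemma ln_cmod_boundary_mean:
  assumes H: "H analytic_on cball 0 1 - {1}" and nz: "\<And>z. z \<in> ball 0 1 \<Longrightarrow> H z \<noteq> 0"
    and le1: "\<And>z. z \<in> cball 0 1 - {1} \<Longrightarrow> cmod (H z) \<le> 1"
    and rad: "((\<lambda>\<rho>. (1 - \<rho>) * ln (cmod (H (of_real \<rho>)))) \<longlongrightarrow> 0) (at_left 1)"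
  shows "((\<lambda>t. ln (cmod (H (cis t)))) has_integral 2 * pi * ln (cmod (H 0))) {0<..<2 * pi}"
    and "(\<lambda>t. ln (cmod (H (cis t)))) absolutely_integrable_on {0<..<2 * pi}"
proof -
  have "H holomorphic_on ball 0 1"
    by (intro analytic_imp_holomorphic analytic_on_subset[OF H]) auto
  then obtain L where L: "L holomorphic_on ball 0 1" "\<And>z. z \<in> ball 0 1 \<Longrightarrow> H z = exp (L z)"
    using contractible_imp_holomorphic_log[of H "ball 0 1"] nz convex_imp_contractible[OF convex_ball] by metis
  define u where "u z = - ln (cmod (H z))" for z
  have uL: "u z = - Re (L z)" if "cmod z < 1" for z
    using L(2)[of z] that by (simp add: u_def)
  \<comment> \<open>At a boundary zero of \<open>H\<close> the convention \<open>ln 0 = 0\<close>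
    gives \<open>u = 0\<close>.\<close>
  have u0: "0 \<le> u z" if "cmod z \<le> 1" "z \<noteq> 1" for z
    using le1[of z] that by (cases "H z = 0") (auto simp: u_def)
  have poisson: "((\<lambda>t. (r\<^sup>2 - \<rho>\<^sup>2) / (cmod (of_real r * cis t - of_real \<rho>))\<^sup>2 * u (of_real r * cis t))
           has_integral 2 * pi * u (of_real \<rho>)) {0..2 * pi}" if "0 \<le> \<rho>" "\<rho> < r" "r < 1" for r \<rho>
  proof -
    from has_integral_linear[OF poisson_integral_circle[OF L(1), of r "of_real \<rho>"] bounded_linear_Re] that
    have "((\<lambda>t. - ((r\<^sup>2 - \<rho>\<^sup>2) / (cmod (of_real r * cis t - of_real \<rho>))\<^sup>2 * Re (L (of_real r * cis t))))
           has_integral - (2 * pi * Re (L (of_real \<rho>)))) {0..2 * pi}"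
      by (intro has_integral_neg) (simp add: o_def)
    then show ?thesis using that by (simp add: uL norm_mult)
  qed
  define r where "r k = 1 - 1 / (real k + 2)" for k :: nat
  have r: "0 < r k" "r k < 1" for k by (auto simp: r_def field_simps)
  have rlim: "r \<longlonglongrightarrow> 1" unfolding r_def by real_asymp
  have mean: "((\<lambda>t. u (of_real (r k) * cis t)) has_integral 2 * pi * u 0) {0..2 * pi}" for k
    using poisson[of 0 "r k"] r[of k] by (simp add: norm_mult)
  \<comment> \<open>Removing the arc of half-width \<open>a\<close> around the exceptional point
    costs at most a multiple of \<open>a * u (1 - a)\<close>, which tends to 0 with \<open>a\<close>
    by \<open>rad\<close>.\<close>
  have mid: "(\<lambda>t. u (cis t)) integrable_on {a..2 * pi - a}"
            "\<bar>integral {a..2 * pi - a} (\<lambda>t. u (cis t)) - 2 * pi * u 0\<bar> \<le> 8 * pi * (a * u (of_real (1 - a)))"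
    if a: "0 < a" "a < 1" for a
  proof -
    let ?I = "{a..2 * pi - a}"
    have sub: "?I \<subseteq> {0..2 * pi}" using a by auto
    obtain Z d D where Z: "finite Z" "d > 0" "D integrable_on ?I"
      and D: "\<And>t r. \<lbrakk>t \<in> ?I - Z; 1 - d < r; r \<le> 1\<rbrakk> \<Longrightarrow> H (of_real r * cis t) \<noteq> 0 \<and> u (of_real r * cis t) \<le> D t"
      using neg_ln_cmod_domination[OF H nz a(1)] unfolding u_def by metis
    have "eventually (\<lambda>k. r k > 1 - min d a) sequentially"
      using rlim Z(2) a by (intro order_tendstoD) auto
    then obtain k0 where k0: "\<And>k. k \<ge> k0 \<Longrightarrow> r k > 1 - d \<and> r k > 1 - a"
      unfolding eventually_sequentially by (smt (verit))
    define f where "f k t = u (of_real (r (k + k0)) * cis t)" for k t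
    have ne1: "of_real (r k) * cis t \<noteq> 1" for k t
      using r[of k] by (metis less_irrefl norm_mult norm_cis norm_one norm_of_real abs_of_pos mult.right_neutral)
    have f0: "0 \<le> f k t" for k t
      unfolding f_def using r[of "k + k0"] ne1 by (intro u0) (auto simp: norm_mult)
    \<comment> \<open>Pointwise convergence and domination are known only off the finite set
      \<open>Z\<close>, so the integrals are moved to \<open>?I - Z\<close>, which does not change
      them.\<close>
    have "negligible {t \<in> ?I - Z - ?I. g t \<noteq> 0}" "negligible {t \<in> ?I - (?I - Z). g t \<noteq> 0}" for g :: "real \<Rightarrow> real"
      using Z(1) by (auto intro: negligible_subset[OF negligible_finite])
    from has_integral_spike_set_eq[OF this]
    have spike: "g integrable_on (?I - Z) \<longleftrightarrow> g integrable_on ?I" "integral (?I - Z) g = integral ?I g" for g :: "real \<Rightarrow> real"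
      unfolding integrable_on_def integral_def by auto
    have fint: "f k integrable_on ?I" for k
      unfolding f_def by (rule integrable_on_subinterval[OF has_integral_integrable[OF mean] sub])
    have conv: "(\<lambda>k. f k t) \<longlonglongrightarrow> u (cis t)" if "t \<in> ?I - Z" for t
    proof -
      have "cis t \<noteq> 1" using that a by (intro cis_neq_1) auto
      then have t: "cis t \<in> cball 0 1 - {1}" by simp
      then have "H analytic_on {cis t}" using H by (meson analytic_on_subset empty_subsetI insert_subset)
      then have c: "isCont H (cis t)" by (rule analytic_at_imp_isCont)
      have nz: "H (cis t) \<noteq> 0" using D[OF that, of 1] Z(2) by simp
      have "isCont u (cis t)" unfolding u_def using c nz by (intro continuous_intros) auto
      moreover have "(\<lambda>k. of_real (r (k + k0)) * cis t) \<longlonglongrightarrow> of_real 1 * cis t"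
        by (intro tendsto_intros LIMSEQ_ignore_initial_segment rlim)
      ultimately show ?thesis unfolding f_def by (metis isCont_tendsto_compose mult_1 of_real_1)
    qed
    have "f k integrable_on (?I - Z)" "D integrable_on (?I - Z)" for k
      using fint Z(3) spike by auto
    moreover have "norm (f k t) \<le> D t" if "t \<in> ?I - Z" for k t
      using D[OF that, of "r (k + k0)"] k0[of "k + k0"] r[of "k + k0"] f0[of k t] by (simp add: f_def)
    ultimately have dc: "(\<lambda>t. u (cis t)) integrable_on (?I - Z)"
      "(\<lambda>k. integral (?I - Z) (f k)) \<longlonglongrightarrow> integral (?I - Z) (\<lambda>t. u (cis t))"
      using dominated_convergence[of f "?I - Z" D "\<lambda>t. u (cis t)"] conv by blast+
    show int: "(\<lambda>t. u (cis t)) integrable_on ?I"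
      using dc(1) spike by simp
    have lim: "(\<lambda>k. integral ?I (f k)) \<longlonglongrightarrow> integral ?I (\<lambda>t. u (cis t))"
      using dc(2) spike by simp
    \<comment> \<open>With this constant, \<open>C k\<close> times the Poisson kernel of
      \<open>1 - a\<close> is at least 1 on the removed arc. As \<open>k\<close> grows it tends to
      \<open>4 * a / (2 - a)\<close>, which is at most \<open>4 * a\<close>.\<close>
    define C where "C k = 4 * a\<^sup>2 / ((r (k + k0))\<^sup>2 - (1 - a)\<^sup>2)" for k
    have bound: "\<bar>integral ?I (f k) - 2 * pi * u 0\<bar> \<le> C k * (2 * pi * u (of_real (1 - a)))" for k
    proof -
      let ?P = "\<lambda>t. ((r (k + k0))\<^sup>2 - (1 - a)\<^sup>2) / (cmod (of_real (r (k + k0)) * cis t - of_real (1 - a)))\<^sup>2"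
      have rk: "1 - a < r (k + k0)" "r (k + k0) < 1" using k0[of "k + k0"] r by auto
      have sq: "(1 - a)\<^sup>2 < (r (k + k0))\<^sup>2" using a rk by (intro power_strict_mono) auto
      then have C0: "0 \<le> C k" by (simp add: C_def)
      have P: "((\<lambda>t. C k * (?P t * f k t)) has_integral C k * (2 * pi * u (of_real (1 - a)))) {0..2 * pi}"
        unfolding f_def using poisson[of "1 - a" "r (k + k0)"] a rk by (intro has_integral_mult_right) auto
      have "((\<lambda>t. if t \<in> ?I then f k t else 0) has_integral integral ?I (f k)) {0..2 * pi}"
        by (rule has_integral_restrict[OF sub, THEN iffD2, OF integrable_integral[OF fint]])
      from has_integral_diff[OF mean[of "k + k0"] this]
      \<comment> \<open>The mass of \<open>f k\<close> on the removed arc; since \<open>f k\<close>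
        is nonnegative, it lies between 0 and the Poisson integral \<open>P\<close>.\<close>
      have E: "((\<lambda>t. if t \<in> ?I then 0 else f k t) has_integral 2 * pi * u 0 - integral ?I (f k)) {0..2 * pi}"
        by (rule has_integral_eq[rotated]) (auto simp: f_def)
      have "0 \<le> 2 * pi * u 0 - integral ?I (f k)"
        using f0 by (intro has_integral_nonneg[OF E]) auto
      moreover have "2 * pi * u 0 - integral ?I (f k) \<le> C k * (2 * pi * u (of_real (1 - a)))"
      proof (rule has_integral_le[OF E P])
        fix t assume t: "t \<in> {0..2 * pi}"
        show "(if t \<in> ?I then 0 else f k t) \<le> C k * (?P t * f k t)"
        proof (cases "t \<in> ?I")
          case True
          then show ?thesis using C0 f0 sq by simp
        next
          case False
          then have "1 \<le> C k * ?P t"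
            unfolding C_def by (intro poisson_kernel_end_arc_ge a rk t)
          then have "1 * f k t \<le> C k * ?P t * f k t" using f0 by (intro mult_right_mono) auto
          then show ?thesis using False by (simp only: if_False mult_1_left mult.assoc)
        qed
      qed
      ultimately show ?thesis by linarith
    qed
    have "(1 - a)\<^sup>2 < 1\<^sup>2" using a by (intro power_strict_mono) auto
    then have "C \<longlonglongrightarrow> 4 * a\<^sup>2 / (1\<^sup>2 - (1 - a)\<^sup>2)" unfolding C_def
      by (intro tendsto_intros LIMSEQ_ignore_initial_segment rlim) auto
    then have Clim: "(\<lambda>k. C k * (2 * pi * u (of_real (1 - a)))) \<longlonglongrightarrow> 4 * a\<^sup>2 / (1\<^sup>2 - (1 - a)\<^sup>2) * (2 * pi * u (of_real (1 - a)))"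
      by (intro tendsto_intros)
    have "(\<lambda>k. \<bar>integral ?I (f k) - 2 * pi * u 0\<bar>) \<longlonglongrightarrow> \<bar>integral ?I (\<lambda>t. u (cis t)) - 2 * pi * u 0\<bar>"
      by (intro tendsto_intros lim)
    from LIMSEQ_le[OF this Clim]
    have "\<bar>integral ?I (\<lambda>t. u (cis t)) - 2 * pi * u 0\<bar> \<le> 4 * a\<^sup>2 / (1\<^sup>2 - (1 - a)\<^sup>2) * (2 * pi * u (of_real (1 - a)))"
      using bound by blast
    also have "4 * a\<^sup>2 / (1\<^sup>2 - (1 - a)\<^sup>2) = 4 * a / (2 - a)"
      using a by (simp add: power2_eq_square divide_simps) (simp add: algebra_simps)
    also have "4 * a / (2 - a) * (2 * pi * u (of_real (1 - a))) \<le> 4 * a * (2 * pi * u (of_real (1 - a)))"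
    proof (rule mult_right_mono)
      show "4 * a / (2 - a) \<le> 4 * a" using a by (simp add: divide_simps)
      have "cmod (of_real (1 - a)) < 1" using a by (simp del: of_real_diff)
      then show "0 \<le> 2 * pi * u (of_real (1 - a))" by (intro mult_nonneg_nonneg u0) auto
    qed
    finally show "\<bar>integral ?I (\<lambda>t. u (cis t)) - 2 * pi * u 0\<bar> \<le> 8 * pi * (a * u (of_real (1 - a)))" by (simp add: mult_ac)
  qed
  define a where "a k = 1 / (real k + 2)" for k :: nat
  have a: "0 < a k" "a k < 1" "a (Suc k) \<le> a k" for k by (auto simp: a_def field_simps)
  have alim: "a \<longlonglongrightarrow> 0" unfolding a_def by real_asymp
  \<comment> \<open>The truncations increase to \<open>u (cis t)\<close> because \<open>u\<close> is
    nonnegative, and their integrals converge by \<open>mid\<close>; monotone convergence then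
    yields the full integral.\<close>
  define F where "F k t = (if t \<in> {a k..2 * pi - a k} then u (cis t) else 0)" for k t
  have sub: "{a k..2 * pi - a k} \<subseteq> {0<..<2 * pi}" for k using a[of k] by auto
  have Fint: "F k integrable_on {0<..<2 * pi}" "integral {0<..<2 * pi} (F k) = integral {a k..2 * pi - a k} (\<lambda>t. u (cis t))" for k
    using has_integral_restrict[OF sub, THEN iffD2, OF integrable_integral[OF mid(1)[OF a(1,2)]]]
    unfolding F_def by (rule has_integral_integrable, rule integral_unique)
  have "a k \<noteq> 0" for k using a(1)[of k] by simp
  then have "filterlim (\<lambda>k. 1 - a k) (at_left 1) sequentially"
    using alim a unfolding filterlim_at by (auto intro!: tendsto_eq_intros)
  from filterlim_compose[OF rad this]
  have "(\<lambda>k. a k * ln (cmod (H (of_real (1 - a k))))) \<longlonglongrightarrow> 0" by simp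
  then have "(\<lambda>k. 8 * pi * - (a k * ln (cmod (H (of_real (1 - a k)))))) \<longlonglongrightarrow> 8 * pi * - 0"
    by (intro tendsto_intros)
  then have "(\<lambda>k. 8 * pi * (a k * u (of_real (1 - a k)))) \<longlonglongrightarrow> 0" by (simp add: u_def)
  then have "(\<lambda>k. integral {0<..<2 * pi} (F k) - 2 * pi * u 0) \<longlonglongrightarrow> 0"
    by (rule Lim_null_comparison[rotated]) (use mid(2)[OF a(1,2)] Fint(2) in simp)
  then have Flim: "(\<lambda>k. integral {0<..<2 * pi} (F k)) \<longlonglongrightarrow> 2 * pi * u 0"
    by (simp add: LIM_zero_iff)
  have ucis0: "0 \<le> u (cis t)" if "t \<in> {0<..<2 * pi}" for t
    using that cis_neq_1[of t] by (intro u0) auto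
  have "(\<lambda>t. u (cis t)) integrable_on {0<..<2 * pi} \<and>
        (\<lambda>k. integral {0<..<2 * pi} (F k)) \<longlonglongrightarrow> integral {0<..<2 * pi} (\<lambda>t. u (cis t))"
  proof (rule monotone_convergence_increasing)
    show "F k t \<le> F (Suc k) t" if "t \<in> {0<..<2 * pi}" for k t
      using ucis0[OF that] a(3)[of k] by (auto simp: F_def)
    show "(\<lambda>k. F k t) \<longlonglongrightarrow> u (cis t)" if "t \<in> {0<..<2 * pi}" for t
    proof (rule tendsto_eventually)
      have "eventually (\<lambda>k. a k < min t (2 * pi - t)) sequentially"
        using alim that by (intro order_tendstoD) auto
      then show "eventually (\<lambda>k. F k t = u (cis t)) sequentially"
        by eventually_elim (auto simp: F_def)
    qed
    show "bounded (range (\<lambda>k. integral {0<..<2 * pi} (F k)))"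
      using Flim by (intro convergent_imp_bounded)
  qed (use Fint in auto)
  then have I: "((\<lambda>t. u (cis t)) has_integral 2 * pi * u 0) {0<..<2 * pi}"
    using Flim LIMSEQ_unique by (metis has_integral_integrable_integral)
  from has_integral_neg[OF this]
  show "((\<lambda>t. ln (cmod (H (cis t)))) has_integral 2 * pi * ln (cmod (H 0))) {0<..<2 * pi}"
    by (simp add: u_def)
  have "(\<lambda>t. u (cis t)) absolutely_integrable_on {0<..<2 * pi}"
    using I ucis0 by (intro nonnegative_absolutely_integrable_1) auto
  from absolutely_integrable_scaleR_left[OF this, of "-1"]
  show "(\<lambda>t. ln (cmod (H (cis t)))) absolutely_integrable_on {0<..<2 * pi}"
    by (simp add: u_def)
qed

subsection \<open>The Poisson formula on the right half plane\<close>

lemma arctan_affine_image: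
  assumes "\<sigma> > (0::real)"
  shows "(\<lambda>\<omega>. pi - 2 * arctan ((\<omega> - \<eta>) / \<sigma>)) ` UNIV = {0<..<2 * pi}"
proof (intro equalityI subsetI)
  fix t assume "t \<in> (\<lambda>\<omega>. pi - 2 * arctan ((\<omega> - \<eta>) / \<sigma>)) ` UNIV"
  then obtain \<omega> where "t = pi - 2 * arctan ((\<omega> - \<eta>) / \<sigma>)" by auto
  then show "t \<in> {0<..<2 * pi}" using arctan_bounded[of "(\<omega> - \<eta>) / \<sigma>"] by auto
next
  fix t assume t: "t \<in> {0<..<2 * pi}"
  have "arctan (tan ((pi - t) / 2)) = (pi - t) / 2" using t by (intro arctan_tan) auto
  then have "t = pi - 2 * arctan ((\<eta> + \<sigma> * tan ((pi - t) / 2) - \<eta>) / \<sigma>)" using assms by simp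
  then show "t \<in> (\<lambda>\<omega>. pi - 2 * arctan ((\<omega> - \<eta>) / \<sigma>)) ` UNIV" by blast
qed

text \<open>With \<open>c\<close> and \<open>s\<close> the cosine and sine of
  \<open>arctan x\<close>, the numerator is \<open>2 * s * (s + \<i> * c)\<close> and the
  denominator \<open>2 * c * (c - \<i> * s)\<close>. As
  \<open>s + \<i> * c = \<i> * (c - \<i> * s)\<close>, the quotient is \<open>\<i> * s / c\<close>.
  So these angles invert the Cayley map on the boundary.\<close>

lemma cayley_cis_arctan:
  "(1 + cis (pi - 2 * arctan x)) / (1 - cis (pi - 2 * arctan x)) = \<i> * of_real x"
proof -
  define c where "c = cos (arctan x)"
  define s where "s = sin (arctan x)"
  have c: "c > 0" unfolding c_def by (simp add: cos_arctan add_pos_nonneg)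
  have sx: "s = x * c" by (simp add: s_def c_def sin_arctan cos_arctan)
  have cs: "c\<^sup>2 + s\<^sup>2 = 1" unfolding c_def s_def by simp
  have w: "cis (pi - 2 * arctan x) = Complex (s\<^sup>2 - c\<^sup>2) (2 * s * c)"
    by (simp add: complex_eq_iff cos_diff sin_diff cos_double sin_double c_def s_def)
  have "1 + cis (pi - 2 * arctan x) = of_real (2 * s) * Complex s c"
    unfolding w using cs by (simp add: complex_eq_iff power2_eq_square)
  moreover have "1 - cis (pi - 2 * arctan x) = of_real (2 * c) * Complex c (- s)"
    unfolding w using cs by (simp add: complex_eq_iff power2_eq_square)
  moreover have "of_real (2 * s) * Complex s c = \<i> * of_real x * (of_real (2 * c) * Complex c (- s))"
    unfolding sx by (simp add: complex_eq_iff)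
  moreover have "of_real (2 * c) * Complex c (- s) \<noteq> 0" using c by (simp add: complex_eq_iff)
  ultimately show ?thesis by simp
qed

text \<open>The Cayley map \<open>\<phi>\<close> sends the disc to the right half plane, 0 to
  \<open>Complex \<sigma> \<eta>\<close> and 1 to infinity, so the mean value formula at 0 becomes
  the Poisson formula at that point. The limit hypothesis excludes factors such as
  \<open>exp (- s)\<close>, which have modulus 1 on the axis and would add a term linear in
  \<open>\<sigma>\<close>.\<close>

lemma poisson_half_plane_bounded:
  fixes \<sigma> \<eta> :: real
  assumes h: "h analytic_on {s. Re s \<ge> 0}" and nz: "\<And>s. Re s > 0 \<Longrightarrow> h s \<noteq> 0"
    and le1: "\<And>s. Re s \<ge> 0 \<Longrightarrow> cmod (h s) \<le> 1"
    and lim: "((\<lambda>x. ln (cmod (h (Complex x \<eta>))) / x) \<longlongrightarrow> 0) at_top" and \<sigma>: "\<sigma> > 0"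
  shows "has_bochner_integral lborel
           (\<lambda>\<omega>. ln (cmod (h (\<i> * of_real \<omega>))) * (\<sigma> / (\<sigma>\<^sup>2 + (\<omega> - \<eta>)\<^sup>2)))
           (pi * ln (cmod (h (Complex \<sigma> \<eta>))))"
proof -
  define \<phi> where "\<phi> w = of_real \<sigma> * ((1 + w) / (1 - w)) + \<i> * of_real \<eta>" for w
  define H where "H = h \<circ> \<phi>"
  have Re_\<phi>: "Re (\<phi> w) = \<sigma> * (1 - (cmod w)\<^sup>2) / (cmod (1 - w))\<^sup>2" for w
    unfolding \<phi>_def cmod_power2
    by (simp add: Re_divide power2_eq_square algebra_simps)
  have ge: "Re (\<phi> w) \<ge> 0" if "cmod w \<le> 1" for w
    using that \<sigma> by (auto simp: Re_\<phi> intro!: divide_nonneg_nonneg mult_nonneg_nonneg power_le_one)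
  have gt: "Re (\<phi> w) > 0" if "cmod w < 1" for w
  proof -
    have "w \<noteq> 1" using that by auto
    moreover have "(cmod w)\<^sup>2 < 1" using that by (simp add: power_less_one_iff)
    ultimately show ?thesis using \<sigma> by (simp add: Re_\<phi>)
  qed
  have \<phi>: "\<phi> analytic_on cball 0 1 - {1}"
    unfolding \<phi>_def by (intro analytic_intros) auto
  have H: "H analytic_on cball 0 1 - {1}"
    unfolding H_def using ge by (intro analytic_on_compose[OF \<phi>] analytic_on_subset[OF h]) auto
  have \<phi>0: "\<phi> 0 = Complex \<sigma> \<eta>" by (simp add: \<phi>_def complex_eq_iff)
  have rad: "((\<lambda>\<rho>. (1 - \<rho>) * ln (cmod (H (of_real \<rho>)))) \<longlongrightarrow> 0) (at_left 1)"
  proof -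
    \<comment> \<open>Substituting \<open>x = \<sigma> * (1 + \<rho>) / (1 - \<rho>)\<close> gives
      \<open>1 - \<rho> = \<sigma> * (1 + \<rho>) / x\<close>, which turns decay relative to
      \<open>x\<close> into the radial condition.\<close>
    have "filterlim (\<lambda>\<rho>. \<sigma> * ((1 + \<rho>) / (1 - \<rho>))) at_top (at_left 1)"
      using \<sigma> by real_asymp
    from filterlim_compose[OF lim this]
    have "((\<lambda>\<rho>. \<sigma> * (1 + \<rho>) * (ln (cmod (h (Complex (\<sigma> * ((1 + \<rho>) / (1 - \<rho>))) \<eta>))) / (\<sigma> * ((1 + \<rho>) / (1 - \<rho>)))))
            \<longlongrightarrow> \<sigma> * (1 + 1) * 0) (at_left 1)"
      by (intro tendsto_intros)
    then have "((\<lambda>\<rho>. \<sigma> * (1 + \<rho>) * (ln (cmod (h (Complex (\<sigma> * ((1 + \<rho>) / (1 - \<rho>))) \<eta>))) / (\<sigma> * ((1 + \<rho>) / (1 - \<rho>)))))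
            \<longlongrightarrow> 0) (at_left 1)" by simp
    moreover have "\<forall>\<^sub>F \<rho> in at_left 1. \<sigma> * (1 + \<rho>) * (ln (cmod (h (Complex (\<sigma> * ((1 + \<rho>) / (1 - \<rho>))) \<eta>))) / (\<sigma> * ((1 + \<rho>) / (1 - \<rho>))))
         = (1 - \<rho>) * ln (cmod (H (of_real \<rho>)))"
      using eventually_at_left_real[OF zero_less_one]
    proof eventually_elim
      case (elim \<rho>)
      have "\<phi> (of_real \<rho>) = Complex (\<sigma> * ((1 + \<rho>) / (1 - \<rho>))) \<eta>"
        by (simp add: \<phi>_def Complex_eq)
      moreover have "\<sigma> * (1 + \<rho>) * (y / (\<sigma> * ((1 + \<rho>) / (1 - \<rho>)))) = (1 - \<rho>) * y" for y
        using \<sigma> elim by (simp add: divide_simps)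
      ultimately show ?case by (simp only: H_def o_apply)
    qed
    ultimately show ?thesis by (rule Lim_transform_eventually)
  qed
  note mean = ln_cmod_boundary_mean[OF H _ _ rad]
  have mean: "(\<lambda>t. ln (cmod (H (cis t)))) absolutely_integrable_on {0<..<2 * pi} \<and>
      integral {0<..<2 * pi} (\<lambda>t. ln (cmod (H (cis t)))) = 2 * pi * ln (cmod (H 0))"
    using mean nz le1 ge gt by (simp add: H_def integral_unique)
  define g where "g \<omega> = pi - 2 * arctan ((\<omega> - \<eta>) / \<sigma>)" for \<omega>
  \<comment> \<open>The boundary angle has derivative minus twice the Poisson kernel; this factor 2
    turns \<open>2 * pi\<close> into \<open>pi\<close>.\<close>
  define g' where "g' \<omega> = - (2 * \<sigma> / (\<sigma>\<^sup>2 + (\<omega> - \<eta>)\<^sup>2))" for \<omega>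
  have sq: "\<sigma>\<^sup>2 + (\<omega> - \<eta>)\<^sup>2 > 0" for \<omega> using \<sigma> by (simp add: add_pos_nonneg)
  have der: "(g has_real_derivative g' \<omega>) (at \<omega>)" for \<omega>
    unfolding g_def g'_def using \<sigma> sq[of \<omega>]
    by (auto intro!: derivative_eq_intros simp: divide_simps power2_eq_square)
  have "inj_on g UNIV" using \<sigma> by (auto simp: g_def inj_on_def arctan_eq_iff)
  moreover have "H (cis (g \<omega>)) = h (\<i> * of_real \<omega>)" for \<omega>
    using \<sigma> by (simp add: H_def g_def \<phi>_def cayley_cis_arctan field_simps)
  ultimately have cov: "(\<lambda>\<omega>. \<bar>g' \<omega>\<bar> * ln (cmod (h (\<i> * of_real \<omega>)))) absolutely_integrable_on UNIV"
     "integral UNIV (\<lambda>\<omega>. \<bar>g' \<omega>\<bar> * ln (cmod (h (\<i> * of_real \<omega>)))) = 2 * pi * ln (cmod (H 0))"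
    using has_absolute_integral_change_of_variables_1'[of UNIV g g' "\<lambda>t. ln (cmod (H (cis t)))" "2 * pi * ln (cmod (H 0))"]
      mean arctan_affine_image[OF \<sigma>, of \<eta>] der by (auto simp: g_def)
  define f where "f \<omega> = ln (cmod (h (\<i> * of_real \<omega>))) * (\<sigma> / (\<sigma>\<^sup>2 + (\<omega> - \<eta>)\<^sup>2))" for \<omega>
  have f: "f = (\<lambda>\<omega>. (1 / 2) * (\<bar>g' \<omega>\<bar> * ln (cmod (h (\<i> * of_real \<omega>)))))"
    using sq \<sigma> by (simp add: f_def g'_def fun_eq_iff abs_of_pos abs_minus_cancel)
  \<comment> \<open>Absolute integrability refers to the completed Lebesgue measure; continuity on
    the axis supplies the Borel measurability required over \<open>lborel\<close>.\<close>
  have "continuous_on UNIV (\<lambda>\<omega>::real. h (\<i> * of_real \<omega>))"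
    by (intro continuous_on_compose2[OF holomorphic_on_imp_continuous_on[OF analytic_imp_holomorphic[OF h]]]
      continuous_intros) auto
  then have meas: "f \<in> borel_measurable lborel"
    unfolding f_def by (intro borel_measurable_times borel_measurable_ln borel_measurable_norm)
      (auto intro!: borel_measurable_continuous_onI borel_measurable_divide continuous_on_norm)
  have "f absolutely_integrable_on UNIV"
    unfolding f using absolutely_integrable_scaleR_left[OF cov(1), of "1/2"] by simp
  then have int: "integrable lborel f"
    using meas by (simp add: set_integrable_def integrable_completion)
  have "integral UNIV f = pi * ln (cmod (h (Complex \<sigma> \<eta>)))"
    unfolding f by (simp add: cov(2) H_def \<phi>0)
  then show ?thesis
    using int integral_lborel[OF int] unfolding f_def has_bochner_integral_iff by simp
qed

text \<open>With a dead time there can be infinitely many zeros on the axis. Being countable, they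
  form a null set, so the logarithm laws may fail there without affecting integrals.\<close>

lemma countable_imaginary_axis_zeros:
  assumes h: "h holomorphic_on UNIV" and z: "h z \<noteq> 0"
  shows "countable {\<omega>. h (\<i> * of_real \<omega>) = 0}"
proof (cases "h constant_on UNIV")
  case True
  then have "{\<omega>. h (\<i> * of_real \<omega>) = 0} = {}"
    using z by (auto simp: constant_on_def)
  then show ?thesis by (simp only: countable_empty)
next
  case False
  have "countable {z\<in>UNIV. h z = 0}"
    using h False by (intro holomorphic_countable_zeros) auto
  then have "countable ((\<lambda>\<omega>. \<i> * complex_of_real \<omega>) ` {\<omega>. h (\<i> * of_real \<omega>) = 0})"
    by (rule countable_subset[rotated]) auto
  then show ?thesis by (rule countable_image_inj_on) (auto simp: inj_on_def)
qed

text \<open>Polynomial growth is compensated by powers of \<open>e s = 1 / (A * (1 + s))\<close>: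
  both \<open>e\<close> and \<open>k = h * e ^ Suc n\<close> are bounded by 1, and
  \<open>ln |h|\<close> is recovered as \<open>ln |k| - Suc n * ln |e|\<close>. The lower bound
  \<open>c\<close> on the ray keeps \<open>ln |h| / x\<close> from having a negative limit.\<close>

lemma poisson_half_plane:
  fixes \<sigma> \<eta> c :: real
  assumes h: "h holomorphic_on UNIV" and nz: "\<And>s. Re s > 0 \<Longrightarrow> h s \<noteq> 0"
    and growth: "\<And>s. Re s \<ge> 0 \<Longrightarrow> cmod (h s) \<le> K * cmod (1 + s) ^ n"
    and c: "c > 0" "eventually (\<lambda>x. c \<le> cmod (h (Complex x \<eta>))) at_top" and \<sigma>: "\<sigma> > 0"
  shows "has_bochner_integral lborel
           (\<lambda>\<omega>. ln (cmod (h (\<i> * of_real \<omega>))) * (\<sigma> / (\<sigma>\<^sup>2 + (\<omega> - \<eta>)\<^sup>2)))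
           (pi * ln (cmod (h (Complex \<sigma> \<eta>))))"
proof -
  \<comment> \<open>\<open>A \<ge> 1\<close> makes \<open>e\<close> bounded by 1. The exponent
    \<open>Suc n\<close> contributes at least one factor \<open>A\<close>, even for
    \<open>n = 0\<close>, which absorbs \<open>K\<close>.\<close>
  define A where "A = max K 1"
  have A: "A \<ge> 1" "A \<ge> K" by (auto simp: A_def)
  define e where "e s = 1 / (of_real A * (1 + s))" for s :: complex
  define k where "k s = h s * e s ^ Suc n" for s
  have s1: "1 + s \<noteq> 0" "cmod (1 + s) \<ge> 1" if "Re s \<ge> 0" for s
    using that complex_Re_le_cmod[of "1 + s"] by (auto simp: complex_eq_iff)
  have e: "e analytic_on {s. Re s \<ge> 0}"
    unfolding e_def using A s1 by (intro analytic_intros) auto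
  have k: "k analytic_on {s. Re s \<ge> 0}"
    unfolding k_def using h by (intro analytic_intros e) (auto simp: analytic_on_open intro: analytic_on_subset[of _ UNIV])
  have e0: "e s \<noteq> 0" if "Re s \<ge> 0" for s using A s1[OF that] by (simp add: e_def)
  have ke: "cmod (e s) = 1 / (A * cmod (1 + s))" for s using A by (simp add: e_def norm_divide norm_mult)
  have e1: "cmod (e s) \<le> 1" if "Re s \<ge> 0" for s
    using A mult_mono[OF A(1) s1(2)[OF that]] by (simp add: ke)
  have k1: "cmod (k s) \<le> 1" if "Re s \<ge> 0" for s
  proof -
    have "cmod (h s) \<le> A * cmod (1 + s) ^ n"
      using growth[OF that] A by (meson mult_right_mono norm_ge_zero order_trans zero_le_power)
    also have "\<dots> \<le> A ^ Suc n * cmod (1 + s) ^ Suc n"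
      using A s1[OF that] by (intro mult_mono power_increasing self_le_power) auto
    finally have "cmod (h s) * cmod (e s) ^ Suc n \<le> (A * cmod (1 + s)) ^ Suc n * cmod (e s) ^ Suc n"
      by (intro mult_right_mono) (auto simp: power_mult_distrib mult_ac)
    also have "\<dots> = 1"
      using A s1[OF that] by (simp add: ke power_mult_distrib[symmetric] del: power_Suc)
    finally show ?thesis by (simp add: k_def norm_mult norm_power)
  qed
  have lime: "((\<lambda>x. ln (cmod (e (Complex x \<eta>))) / x) \<longlongrightarrow> 0) at_top"
  proof (rule tendsto_sandwich)
    show "((\<lambda>x. - ln (A * (1 + x + \<bar>\<eta>\<bar>)) / x) \<longlongrightarrow> 0) at_top" using A(1) by real_asymp
    show "\<forall>\<^sub>F x in at_top. - ln (A * (1 + x + \<bar>\<eta>\<bar>)) / x \<le> ln (cmod (e (Complex x \<eta>))) / x"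
      using eventually_gt_at_top[of 0]
    proof eventually_elim
      case (elim x)
      have "cmod (1 + Complex x \<eta>) \<le> \<bar>1 + x\<bar> + \<bar>\<eta>\<bar>"
        using cmod_le[of "1 + Complex x \<eta>"] by simp
      then have "A * cmod (1 + Complex x \<eta>) \<le> A * (1 + x + \<bar>\<eta>\<bar>)"
        using A elim by (intro mult_left_mono) auto
      moreover have "0 < A * cmod (1 + Complex x \<eta>)" using A s1[of "Complex x \<eta>"] elim by simp
      ultimately have "ln (A * cmod (1 + Complex x \<eta>)) \<le> ln (A * (1 + x + \<bar>\<eta>\<bar>))" by (intro ln_mono)
      then show ?case using elim s1(1)[of "Complex x \<eta>"] A by (simp add: ke ln_div divide_right_mono)
    qed
    show "\<forall>\<^sub>F x in at_top. ln (cmod (e (Complex x \<eta>))) / x \<le> 0"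
      using eventually_gt_at_top[of 0]
      by eventually_elim (use e1 e0 in \<open>auto intro!: divide_nonpos_pos\<close>)
  qed auto
  have limk: "((\<lambda>x. ln (cmod (k (Complex x \<eta>))) / x) \<longlongrightarrow> 0) at_top"
  proof (rule tendsto_sandwich)
    have "((\<lambda>x. ln c / x + real (Suc n) * (ln (cmod (e (Complex x \<eta>))) / x)) \<longlongrightarrow> 0 + real (Suc n) * 0) at_top"
      by (intro tendsto_intros lime tendsto_divide_0[OF tendsto_const] filterlim_ident filterlim_at_top_imp_at_infinity)
    then show "((\<lambda>x. ln c / x + real (Suc n) * (ln (cmod (e (Complex x \<eta>))) / x)) \<longlongrightarrow> 0) at_top" by simp
    show "\<forall>\<^sub>F x in at_top. ln c / x + real (Suc n) * (ln (cmod (e (Complex x \<eta>))) / x) \<le> ln (cmod (k (Complex x \<eta>))) / x"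
      using eventually_gt_at_top[of 0] c(2)
    proof eventually_elim
      case (elim x)
      then have "cmod (k (Complex x \<eta>)) = cmod (h (Complex x \<eta>)) * cmod (e (Complex x \<eta>)) ^ Suc n"
        by (simp add: k_def norm_mult norm_power)
      then have "ln (cmod (k (Complex x \<eta>))) = ln (cmod (h (Complex x \<eta>))) + real (Suc n) * ln (cmod (e (Complex x \<eta>)))"
        using e0[of "Complex x \<eta>"] nz[of "Complex x \<eta>"] elim(1) by (simp add: ln_mult ln_realpow del: power_Suc)
      moreover have "ln c \<le> ln (cmod (h (Complex x \<eta>)))" using elim c(1) by (intro ln_mono) auto
      ultimately have "ln c + real (Suc n) * ln (cmod (e (Complex x \<eta>))) \<le> ln (cmod (k (Complex x \<eta>)))" by linarith
      from divide_right_mono[OF this, of x] show ?case using elim by (simp add: add_divide_distrib)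
    qed
    show "\<forall>\<^sub>F x in at_top. ln (cmod (k (Complex x \<eta>))) / x \<le> 0"
      using eventually_gt_at_top[of 0]
    proof eventually_elim
      case (elim x)
      then have "0 < cmod (k (Complex x \<eta>))" using nz e0 by (simp add: k_def)
      then have "ln (cmod (k (Complex x \<eta>))) \<le> 0" using k1[of "Complex x \<eta>"] elim by simp
      then show ?case using elim by (intro divide_nonpos_pos)
    qed
  qed auto
  let ?p = "\<lambda>\<omega>. \<sigma> / (\<sigma>\<^sup>2 + (\<omega> - \<eta>)\<^sup>2)" and ?z = "Complex \<sigma> \<eta>"
  have "has_bochner_integral lborel (\<lambda>\<omega>. ln (cmod (k (\<i> * of_real \<omega>))) * ?p \<omega> -
        real (Suc n) * (ln (cmod (e (\<i> * of_real \<omega>))) * ?p \<omega>))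
     (pi * ln (cmod (k ?z)) - real (Suc n) * (pi * ln (cmod (e ?z))))"
    using e0 nz by (intro has_bochner_integral_diff has_bochner_integral_mult_right
       poisson_half_plane_bounded k k1 limk e e1 lime \<sigma>) (auto simp: k_def)
  also have "pi * ln (cmod (k ?z)) - real (Suc n) * (pi * ln (cmod (e ?z))) = pi * ln (cmod (h ?z))"
    using nz[of ?z] e0[of ?z] \<sigma>
    by (simp add: k_def norm_mult norm_power ln_mult ln_realpow algebra_simps del: power_Suc)
  finally have *: "has_bochner_integral lborel (\<lambda>\<omega>. ln (cmod (k (\<i> * of_real \<omega>))) * ?p \<omega> -
        real (Suc n) * (ln (cmod (e (\<i> * of_real \<omega>))) * ?p \<omega>)) (pi * ln (cmod (h ?z)))" .
  \<comment> \<open>The two integrands agree off the zeros of \<open>h\<close>; at a zero,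
    \<open>ln 0 = 0\<close> on both sides leaves the terms in \<open>e\<close> over, so a countable
    set is discarded.\<close>
  have "h ?z \<noteq> 0" using nz \<sigma> by simp
  from has_bochner_integral_discrete_difference[OF countable_imaginary_axis_zeros[OF h this], of lborel, THEN iffD1, OF _ _ _ *]
  show ?thesis
  proof (rule meta_mp)
    fix \<omega> assume "\<omega> \<notin> {\<omega>. h (\<i> * of_real \<omega>) = 0}"
    then show "ln (cmod (k (\<i> * of_real \<omega>))) * ?p \<omega> - real (Suc n) * (ln (cmod (e (\<i> * of_real \<omega>))) * ?p \<omega>)
        = ln (cmod (h (\<i> * of_real \<omega>))) * ?p \<omega>"
      using e0[of "\<i> * of_real \<omega>"]
      by (simp add: k_def norm_mult norm_power ln_mult ln_realpow algebra_simps add_divide_distrib del: power_Suc)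
  qed auto
qed

section \<open>Reflecting zeros across the imaginary axis\<close>

lemma entire_zorder_eventually_nonzero:
  assumes "F holomorphic_on UNIV" "F z \<noteq> 0"
  shows "F analytic_on {s}" "eventually (\<lambda>w. F w \<noteq> 0) (at s)"
  using assms non_zero_neighbour_alt[of F UNIV s z]
  by (auto simp: analytic_on_open intro: analytic_on_subset[of _ UNIV] elim: eventually_mono)

lemma zorder_linear:
  "zorder (\<lambda>w::complex. w - a) s = (if s = a then 1 else 0)"
proof (cases "s = a")
  case True
  then show ?thesis by (auto intro!: zorder_eqI[of UNIV a "\<lambda>_. 1"])
next
  case False
  then show ?thesis by (auto intro!: zorder_eq_0I analytic_intros)
qed

text \<open>One zero at \<open>a\<close> is divided out as a removable singularity and replaced by
  one at \<open>- cnj a\<close> in the left half plane. The growth exponent survives: far from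
  \<open>a\<close> the factor is bounded, and near \<open>a\<close> compactness bounds
  \<open>F'\<close>.\<close>

lemma reflect_rhp_zero:
  assumes F: "F holomorphic_on UNIV" and nz: "F z \<noteq> 0" and a: "Re a > 0" "F a = 0"
    and growth: "\<And>s. Re s \<ge> 0 \<Longrightarrow> cmod (F s) \<le> K * cmod (1 + s) ^ n"
  obtains F' K' where "F' holomorphic_on UNIV" "\<And>s. s \<noteq> a \<Longrightarrow> F' s = F s * ((s + cnj a) / (s - a))"
    "\<And>s. Re s > 0 \<Longrightarrow> zorder F' s = zorder F s - (if s = a then 1 else 0)"
    "\<And>s. Re s \<ge> 0 \<Longrightarrow> cmod (F' s) \<le> K' * cmod (1 + s) ^ n"
proof -
  define F1 where "F1 s = (if s = a then deriv F a else F s / (s - a))" for s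
  have "(\<lambda>s. if s = a then deriv F a else F s / (s - a) - F a / (s - a)) holomorphic_on UNIV"
    by (rule pole_theorem[OF F]) auto
  then have F1: "F1 holomorphic_on UNIV" using a by (simp add: F1_def [abs_def] cong: if_cong)
  have F_F1: "F = (\<lambda>s. (s - a) * F1 s)" using a by (auto simp: F1_def fun_eq_iff)
  define F' where "F' s = F1 s * (s + cnj a)" for s
  have F': "F' holomorphic_on UNIV" unfolding F'_def by (intro holomorphic_intros F1)
  have F'_eq: "F' s = F s * ((s + cnj a) / (s - a))" if "s \<noteq> a" for s
    using that by (simp add: F'_def F1_def)
  have F1z: "F1 z \<noteq> 0" using nz F_F1 by (metis mult_zero_right)
  have zord: "zorder F' s = zorder F s - (if s = a then 1 else 0)" if "Re s > 0" for s
  proof -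
    have s: "s + cnj a \<noteq> 0" using that a by (auto simp: complex_eq_iff)
    note F1s = entire_zorder_eventually_nonzero[OF F1 F1z, of s]
    have ne: "eventually (\<lambda>w. w \<in> UNIV - {a, - cnj a}) (at s)"
      using s
      by (intro eventually_at_in_open[of "UNIV - ({a, - cnj a} - {s})" s, THEN eventually_mono])
         (auto intro!: open_Diff finite_imp_closed)
    have "zorder F s = zorder (\<lambda>w. w - a) s + zorder F1 s"
      unfolding F_F1 using eventually_conj[OF ne F1s(2)]
      by (intro zorder_times_analytic F1s analytic_intros) (auto elim: eventually_mono)
    moreover have "zorder F' s = zorder F1 s + zorder (\<lambda>w. w - (- cnj a)) s"
      unfolding F'_def diff_minus_eq_add using eventually_conj[OF ne F1s(2)]
      by (intro zorder_times_analytic F1s analytic_intros) (auto elim!: eventually_mono simp: add_eq_0_iff2)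
    ultimately show ?thesis using s zorder_linear[of "- cnj a" s] by (auto simp: zorder_linear add_eq_0_iff2)
  qed
  have "compact (F' ` cball a 1)"
    by (intro compact_continuous_image compact_cball holomorphic_on_imp_continuous_on holomorphic_on_subset[OF F']) auto
  from compact_imp_bounded[OF this] obtain B where B: "\<And>s. s \<in> cball a 1 \<Longrightarrow> cmod (F' s) \<le> B"
    unfolding bounded_iff by (metis image_eqI)
  \<comment> \<open>\<open>B\<close> serves the unit ball around \<open>a\<close>, where
    \<open>|1 + s| \<ge> 1\<close>; outside it the reflecting factor has modulus at most
    \<open>1 + 2 * |a|\<close>.\<close>
  define K' where "K' = max B (K * (1 + 2 * cmod a))"
  have "cmod (F' s) \<le> K' * cmod (1 + s) ^ n" if s: "Re s \<ge> 0" for s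
  proof (cases "s \<in> cball a 1")
    case True
    then have "0 \<le> B" using B[OF True] by (meson norm_ge_zero order_trans)
    moreover have "1 \<le> cmod (1 + s) ^ n" using s complex_Re_le_cmod[of "1 + s"] by (intro one_le_power) simp
    ultimately have "B * 1 \<le> K' * cmod (1 + s) ^ n" unfolding K'_def by (intro mult_mono) auto
    then show ?thesis using B[OF True] by linarith
  next
    case False
    then have sa: "cmod (s - a) \<ge> 1" "s \<noteq> a" by (auto simp: dist_norm norm_minus_commute)
    have "cmod (s + cnj a) \<le> cmod (s - a) + cmod (a + cnj a)"
      using norm_triangle_ineq[of "s - a" "a + cnj a"] by simp
    also have "\<dots> \<le> cmod (s - a) + 2 * cmod a" using norm_triangle_ineq[of a "cnj a"] by simp
    also have "\<dots> \<le> (1 + 2 * cmod a) * cmod (s - a)"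
      using mult_left_mono[OF sa(1), of "2 * cmod a"] by (simp add: algebra_simps)
    finally have "cmod ((s + cnj a) / (s - a)) \<le> 1 + 2 * cmod a"
      using sa by (simp add: norm_divide divide_le_eq)
    then have "cmod (F' s) \<le> K * cmod (1 + s) ^ n * (1 + 2 * cmod a)"
      unfolding F'_eq[OF sa(2)] norm_mult
      by (rule mult_mono[OF growth[OF s] _ order_trans[OF norm_ge_zero growth[OF s]]]) auto
    also have "\<dots> = K * (1 + 2 * cmod a) * cmod (1 + s) ^ n" by (simp add: mult_ac)
    also have "\<dots> \<le> K' * cmod (1 + s) ^ n" unfolding K'_def by (intro mult_right_mono) auto
    finally show ?thesis .
  qed
  with F' F'_eq zord show ?thesis by (rule that)
qed

text \<open>Induction on the list of zeros: each step reflects the head and lowers its order by one,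
  until no zero is left in the right half plane and \<open>poisson_half_plane\<close>
  applies.\<close>

lemma poisson_half_plane_zeros:
  fixes \<sigma> \<eta> c :: real
  assumes "F holomorphic_on UNIV"
    and "\<And>s. Re s \<ge> 0 \<Longrightarrow> cmod (F s) \<le> K * cmod (1 + s) ^ n"
    and "c > 0" "eventually (\<lambda>x. c \<le> cmod (F (Complex x \<eta>))) at_top"
    and "\<sigma> > 0" "F (Complex \<sigma> \<eta>) \<noteq> 0"
    and "set as \<subseteq> rhp" "\<And>s. s \<in> rhp \<Longrightarrow> int (count_list as s) = zorder F s"
  shows "has_bochner_integral lborel
           (\<lambda>\<omega>. ln (cmod (F (\<i> * of_real \<omega>))) * (\<sigma> / (\<sigma>\<^sup>2 + (\<omega> - \<eta>)\<^sup>2)))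
           (pi * (ln (cmod (F (Complex \<sigma> \<eta>)))
              - (\<Sum>a\<leftarrow>as. ln (cmod ((Complex \<sigma> \<eta> - a) / (Complex \<sigma> \<eta> + cnj a))))))"
  using assms
proof (induction as arbitrary: F K)
  case Nil
  have "F s \<noteq> 0" if "Re s > 0" for s
    using zorder_eq_0_iff[OF entire_zorder_eventually_nonzero(1)[OF Nil(1,6), of s]]
      entire_zorder_eventually_nonzero(2)[OF Nil(1,6), of s] Nil(8)[of s] that
    by (simp add: rhp_def eventually_frequently)
  from poisson_half_plane[OF Nil(1) this Nil(2-5)] show ?case by simp
next
  case (Cons a as)
  let ?z = "Complex \<sigma> \<eta>"
  have a: "Re a > 0" using Cons.prems(7) by (simp add: rhp_def)
  have "zorder F a > 0" using Cons.prems(8)[of a] a by (simp add: rhp_def)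
  then have Fa: "F a = 0"
    using zorder_eq_0I entire_zorder_eventually_nonzero(1)[OF Cons.prems(1,6)] by force
  from reflect_rhp_zero[OF Cons.prems(1,6) a Fa Cons.prems(2)] obtain F' K' where
    F': "F' holomorphic_on UNIV" "\<And>s. s \<noteq> a \<Longrightarrow> F' s = F s * ((s + cnj a) / (s - a))"
    "\<And>s. Re s > 0 \<Longrightarrow> zorder F' s = zorder F s - (if s = a then 1 else 0)"
    "\<And>s. Re s \<ge> 0 \<Longrightarrow> cmod (F' s) \<le> K' * cmod (1 + s) ^ n" by metis
  have za: "?z \<noteq> a" using Fa Cons.prems(6) by auto
  have za': "?z + cnj a \<noteq> 0" using a Cons.prems(5) by (auto simp: complex_eq_iff)
  have count: "int (count_list as s) = zorder F' s" if "s \<in> rhp" for s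
    using Cons.prems(8)[OF that] F'(3)[of s] that by (auto simp: rhp_def)
  have lower: "eventually (\<lambda>x. c \<le> cmod (F' (Complex x \<eta>))) at_top"
    using Cons.prems(4) eventually_gt_at_top[of "Re a"]
  proof eventually_elim
    case (elim x)
    let ?s = "Complex x \<eta>"
    have s: "?s \<noteq> a" using elim by auto
    \<comment> \<open>Points of the right half plane are closer to \<open>a\<close> than to
      \<open>- cnj a\<close>, so reflection only increases the modulus and the bound
      \<open>c\<close> persists.\<close>
    have "(x - Re a)\<^sup>2 \<le> (x + Re a)\<^sup>2" using a elim by (intro power_mono) auto
    then have "cmod (?s - a) \<le> cmod (?s + cnj a)" by (simp add: cmod_def)
    then have "1 \<le> cmod ((?s + cnj a) / (?s - a))" using s by (simp add: norm_divide le_divide_eq)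
    then have "cmod (F ?s) * 1 \<le> cmod (F' ?s)"
      unfolding F'(2)[OF s] norm_mult by (intro mult_left_mono) auto
    then show ?case using elim by linarith
  qed
  have "F' ?z \<noteq> 0" using za za' Cons.prems(6) by (simp add: F'(2))
  from Cons.IH[OF F'(1,4) Cons.prems(3) lower Cons.prems(5) this _ count] Cons.prems(7)
  have *: "has_bochner_integral lborel
           (\<lambda>\<omega>. ln (cmod (F' (\<i> * of_real \<omega>))) * (\<sigma> / (\<sigma>\<^sup>2 + (\<omega> - \<eta>)\<^sup>2)))
           (pi * (ln (cmod (F' ?z)) - (\<Sum>a\<leftarrow>as. ln (cmod ((?z - a) / (?z + cnj a))))))" by simp
  \<comment> \<open>Points of the imaginary axis are equidistant from \<open>a\<close> and
    \<open>- cnj a\<close>, so the integrand is unchanged.\<close>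
  have "cmod (F' (\<i> * of_real \<omega>)) = cmod (F (\<i> * of_real \<omega>))" for \<omega>
  proof -
    have s: "\<i> * of_real \<omega> \<noteq> a" using a by auto
    have "cmod (\<i> * of_real \<omega> + cnj a) = cmod (\<i> * of_real \<omega> - a)" by (simp add: cmod_def)
    then show ?thesis using s by (simp add: F'(2) norm_mult norm_divide)
  qed
  moreover have "ln (cmod (F' ?z)) = ln (cmod (F ?z)) - ln (cmod ((?z - a) / (?z + cnj a)))"
    using za za' Cons.prems(6) by (simp add: F'(2) norm_mult norm_divide ln_mult ln_div)
  ultimately show ?case using * by (simp add: diff_diff_eq)
qed

subsection \<open>Transfer functions\<close>

lemma poly_holomorphic_on [holomorphic_intros]: "poly (p :: complex poly) holomorphic_on A"
  unfolding poly_altdef [abs_def] by (intro holomorphic_intros)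

lemma poly_analytic_on [analytic_intros]: "poly (p :: complex poly) analytic_on A"
  by (rule analytic_on_subset[of _ UNIV]) (auto simp: analytic_on_open intro: poly_holomorphic_on)

section \<open>Growth and lower bounds for \<open>P + Q exp (- t s)\<close>\<close>

lemma polynomial_growth_rhp:
  fixes p :: "complex poly"
  obtains K where "K \<ge> 0" "\<And>s n. \<lbrakk>Re s \<ge> 0; degree p \<le> n\<rbrakk> \<Longrightarrow> cmod (poly p s) \<le> K * cmod (1 + s) ^ n"
proof (rule that[of "\<Sum>i\<le>degree p. cmod (coeff p i)"])
  fix s n assume s: "Re s \<ge> 0" and n: "degree p \<le> n"
  have s1: "1 \<le> cmod (1 + s)" using s complex_Re_le_cmod[of "1 + s"] by simp
  have "cmod s \<le> cmod (1 + s)"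
    using s by (auto simp: cmod_def intro!: real_sqrt_le_mono power_mono)
  then have "cmod s ^ i \<le> cmod (1 + s) ^ n" if "i \<le> degree p" for i
    using s1 n that by (meson norm_ge_zero order_trans power_increasing power_mono)
  then have "(\<Sum>i\<le>degree p. cmod (coeff p i * s ^ i)) \<le> (\<Sum>i\<le>degree p. cmod (coeff p i) * cmod (1 + s) ^ n)"
    by (intro sum_mono) (auto simp: norm_mult norm_power intro!: mult_left_mono)
  then show "cmod (poly p s) \<le> (\<Sum>i\<le>degree p. cmod (coeff p i)) * cmod (1 + s) ^ n"
    unfolding poly_altdef sum_distrib_right by (rule order_trans[OF norm_sum])
qed (auto intro: sum_nonneg)

lemma poly_lower_bound_ray:
  fixes p :: "complex poly"
  assumes "p \<noteq> 0"
  obtains c where "c > 0" "eventually (\<lambda>x. c \<le> cmod (poly p (Complex x \<eta>))) at_top"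
proof (cases "degree p = 0")
  case True
  then obtain a where "p = [:a:]" by (meson degree_eq_zeroE)
  then show ?thesis using assms by (intro that[of "cmod a"]) auto
next
  case False
  obtain a q where p: "p = pCons a q" by (cases p)
  with False have "q \<noteq> 0" by auto
  from poly_infinity[OF this, of 1 a] obtain r where r: "\<And>z. r \<le> cmod z \<Longrightarrow> 1 \<le> cmod (poly p z)"
    unfolding p by auto
  show ?thesis
  proof (rule that[of 1])
    show "eventually (\<lambda>x. 1 \<le> cmod (poly p (Complex x \<eta>))) at_top"
      using eventually_ge_at_top[of r]
    proof eventually_elim
      case (elim x)
      then show ?case using complex_Re_le_cmod[of "Complex x \<eta>"] by (intro r) simp
    qed
  qed simp
qed

lemma exp_poly_growth_rhp:
  fixes p q :: "complex poly" and t :: real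
  assumes "t \<ge> 0"
  obtains K n where "\<And>s. Re s \<ge> 0 \<Longrightarrow> cmod (poly p s + poly q s * exp (- of_real t * s)) \<le> K * cmod (1 + s) ^ n"
proof -
  obtain K where K: "\<And>s n. \<lbrakk>Re s \<ge> 0; degree p \<le> n\<rbrakk> \<Longrightarrow> cmod (poly p s) \<le> K * cmod (1 + s) ^ n"
    using polynomial_growth_rhp by metis
  obtain L where L: "\<And>s n. \<lbrakk>Re s \<ge> 0; degree q \<le> n\<rbrakk> \<Longrightarrow> cmod (poly q s) \<le> L * cmod (1 + s) ^ n"
    using polynomial_growth_rhp by metis
  let ?n = "max (degree p) (degree q)"
  show ?thesis
  proof (rule that[of "K + L" ?n])
    fix s assume s: "Re s \<ge> 0"
    have "cmod (exp (- of_real t * s)) \<le> 1" using s assms by simp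
    then have "cmod (poly q s * exp (- of_real t * s)) \<le> cmod (poly q s)"
      by (simp add: norm_mult mult_left_le)
    then have "cmod (poly p s + poly q s * exp (- of_real t * s)) \<le> cmod (poly p s) + cmod (poly q s)"
      by (meson add_left_mono norm_triangle_ineq order_trans)
    also have "\<dots> \<le> K * cmod (1 + s) ^ ?n + L * cmod (1 + s) ^ ?n"
      using s by (intro add_mono K L) auto
    finally show "cmod (poly p s + poly q s * exp (- of_real t * s)) \<le> (K + L) * cmod (1 + s) ^ ?n"
      by (simp add: algebra_simps)
  qed
qed

text \<open>For \<open>t = 0\<close> this is the nonzero polynomial \<open>p + q\<close>, where
  cancellation of leading terms is harmless. For \<open>t > 0\<close> the exponential beats
  \<open>q\<close> on the ray whatever the degrees, so half the bound for \<open>p\<close>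
  remains.\<close>

lemma exp_poly_lower_bound_ray:
  fixes p q :: "complex poly" and t :: real
  assumes t: "t \<ge> 0" and p: "p \<noteq> 0" and nz: "poly p z + poly q z * exp (- of_real t * z) \<noteq> 0"
  obtains c where "c > 0"
    "eventually (\<lambda>x. c \<le> cmod (poly p (Complex x \<eta>) + poly q (Complex x \<eta>) * exp (- of_real t * Complex x \<eta>))) at_top"
proof (cases "t = 0")
  case True
  then have "poly (p + q) z \<noteq> 0" using nz by simp
  then have "p + q \<noteq> 0" by (metis poly_0)
  from poly_lower_bound_ray[OF this, of \<eta>] show ?thesis using that True by auto
next
  case False
  with t have t: "t > 0" by simp
  obtain c where c: "c > 0" "eventually (\<lambda>x. c \<le> cmod (poly p (Complex x \<eta>))) at_top"
    using poly_lower_bound_ray[OF p] by blast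
  obtain K where K: "K \<ge> 0" "\<And>s n. \<lbrakk>Re s \<ge> 0; degree q \<le> n\<rbrakk> \<Longrightarrow> cmod (poly q s) \<le> K * cmod (1 + s) ^ n"
    using polynomial_growth_rhp by metis
  define n where "n = degree q"
  have "((\<lambda>x. (1 + x + \<bar>\<eta>\<bar>) ^ n * exp (- t * x)) \<longlongrightarrow> 0) at_top"
    using t by real_asymp
  then have "((\<lambda>x. K * ((1 + x + \<bar>\<eta>\<bar>) ^ n * exp (- t * x))) \<longlongrightarrow> K * 0) at_top"
    by (intro tendsto_intros)
  then have "eventually (\<lambda>x. K * ((1 + x + \<bar>\<eta>\<bar>) ^ n * exp (- t * x)) < c / 2) at_top"
    using c(1) by (intro order_tendstoD(2)) auto
  then have "eventually (\<lambda>x. c / 2 \<le> cmod (poly p (Complex x \<eta>) + poly q (Complex x \<eta>) * exp (- of_real t * Complex x \<eta>))) at_top"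
    using c(2) eventually_gt_at_top[of 0]
  proof eventually_elim
    case (elim x)
    let ?s = "Complex x \<eta>"
    have "cmod (1 + ?s) \<le> 1 + x + \<bar>\<eta>\<bar>" using cmod_le[of "1 + ?s"] elim by simp
    then have "cmod (poly q ?s) \<le> K * (1 + x + \<bar>\<eta>\<bar>) ^ n"
      using K(2)[of ?s n] K(1) elim
      by (smt (verit, best) complex.sel(1) mult_left_mono n_def norm_ge_zero order_refl power_mono)
    then have "cmod (poly q ?s * exp (- of_real t * ?s)) \<le> K * (1 + x + \<bar>\<eta>\<bar>) ^ n * exp (- t * x)"
      by (simp add: norm_mult mult_right_mono)
    moreover have "cmod (poly p ?s) - cmod (poly q ?s * exp (- of_real t * ?s)) \<le> cmod (poly p ?s + poly q ?s * exp (- of_real t * ?s))"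
      by (rule norm_diff_ineq)
    ultimately show ?case using elim by (simp add: mult.assoc)
  qed
  then show ?thesis using c(1) by (intro that[of "c / 2"]) auto
qed

section \<open>Reduction of the open loop to a quotient in lowest terms\<close>

lemma cancel_common_roots:
  fixes p q :: "'a::field poly"
  assumes "p \<noteq> 0"
  obtains p' q' where "p' \<noteq> 0" "\<And>s. \<not> (poly p' s = 0 \<and> poly q' s = 0)"
    "\<And>s. poly p s \<noteq> 0 \<Longrightarrow> poly p' s \<noteq> 0 \<and> poly q s / poly p s = poly q' s / poly p' s"
  using assms
proof (induction "degree p" arbitrary: p q thesis rule: less_induct)
  case less
  show ?case
  proof (cases "\<exists>s. poly p s = 0 \<and> poly q s = 0")
    case False
    then show ?thesis using less.prems by blast
  next
    case True
    then obtain s where "poly p s = 0" "poly q s = 0" by blast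
    then obtain p1 q1 where pq: "p = [:-s, 1:] * p1" "q = [:-s, 1:] * q1"
      by (auto simp: poly_eq_0_iff_dvd elim!: dvdE)
    have eval: "poly p x = (x - s) * poly p1 x" "poly q x = (x - s) * poly q1 x" for x
      unfolding pq by (simp_all add: algebra_simps)
    from pq less.prems have "p1 \<noteq> 0" by auto
    then have "degree p1 < degree p" unfolding pq by (subst degree_mult_eq) auto
    from less.hyps[OF this _ \<open>p1 \<noteq> 0\<close>, of q1] obtain p' q' where "p' \<noteq> 0" "\<And>s. \<not> (poly p' s = 0 \<and> poly q' s = 0)"
      "\<And>s. poly p1 s \<noteq> 0 \<Longrightarrow> poly p' s \<noteq> 0 \<and> poly q1 s / poly p1 s = poly q' s / poly p' s"
      by blast
    then show ?thesis by (intro less.prems(1)[of p' q']) (auto simp: eval)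
  qed
qed

lemma eventually_poly_nonzero:
  fixes p :: "complex poly"
  assumes "p \<noteq> 0"
  shows "eventually (\<lambda>w. poly p w \<noteq> 0) (at z)"
proof -
  obtain s where "poly p s \<noteq> 0" using assms poly_all_0_iff_0 by blast
  moreover have "poly p holomorphic_on UNIV" by (intro holomorphic_intros)
  ultimately show ?thesis using entire_zorder_eventually_nonzero by blast
qed

lemma open_loop_eq_quotient:
  assumes "transfer_function Gc" "transfer_function Gp"
  obtains P Q :: "complex poly" and t :: real where "P \<noteq> 0" "t \<ge> 0" "\<And>s. \<not> (poly P s = 0 \<and> poly Q s = 0)"
    "open_loop Gc Gp = remove_sings (\<lambda>s. poly Q s / poly P s * exp (- of_real t * s))"
proof -
  have tf: "\<exists>Q P t. P \<noteq> 0 \<and> t \<ge> 0 \<and> (\<forall>w. poly P w \<noteq> 0 \<longrightarrow> f w = poly Q w / poly P w * exp (- of_real t * w))"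
    if f: "transfer_function f" for f
  proof -
    from f obtain Q P :: "real poly" and t where *: "P \<noteq> 0" "t \<ge> 0"
        "f = remove_sings (\<lambda>s. poly (map_poly of_real Q) s / poly (map_poly of_real P) s * exp (- of_real t * s))"
      unfolding transfer_function_def by blast
    let ?P = "map_poly of_real P :: complex poly"
    have "f w = poly (map_poly of_real Q) w / poly ?P w * exp (- of_real t * w)" if "poly ?P w \<noteq> 0" for w
      unfolding *(3) using that by (intro remove_sings_at_analytic analytic_intros) auto
    moreover have "?P \<noteq> 0" using *(1) by (simp add: map_poly_eq_0_iff)
    ultimately show ?thesis using *(2) by blast
  qed
  obtain Q1 P1 t1 where 1: "P1 \<noteq> 0" "t1 \<ge> 0" "\<And>w. poly P1 w \<noteq> 0 \<Longrightarrow> Gc w = poly Q1 w / poly P1 w * exp (- of_real t1 * w)"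
    using tf[OF assms(1)] by blast
  obtain Q2 P2 t2 where 2: "P2 \<noteq> 0" "t2 \<ge> 0" "\<And>w. poly P2 w \<noteq> 0 \<Longrightarrow> Gp w = poly Q2 w / poly P2 w * exp (- of_real t2 * w)"
    using tf[OF assms(2)] by blast
  have "P1 * P2 \<noteq> 0" using 1 2 by simp
  from cancel_common_roots[OF this, of "Q1 * Q2"] obtain P Q where PQ: "P \<noteq> 0" "\<And>s. \<not> (poly P s = 0 \<and> poly Q s = 0)"
    "\<And>s. poly (P1 * P2) s \<noteq> 0 \<Longrightarrow> poly P s \<noteq> 0 \<and> poly (Q1 * Q2) s / poly (P1 * P2) s = poly Q s / poly P s"
    by blast
  show ?thesis
  proof (rule that[of P "t1 + t2" Q])
    show "open_loop Gc Gp = remove_sings (\<lambda>s. poly Q s / poly P s * exp (- of_real (t1 + t2) * s))"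
      unfolding open_loop_def
    \<comment> \<open>\<open>remove_sings\<close> sees only punctured neighbourhoods, so agreement
      off the roots of \<open>P1 * P2\<close> suffices, and the values that \<open>Gc\<close> and
      \<open>Gp\<close> take at those roots do not matter.\<close>
    proof (rule ext, rule remove_sings_cong[OF _ refl])
      fix z
      show "eventually (\<lambda>w. Gc w * Gp w = poly Q w / poly P w * exp (- of_real (t1 + t2) * w)) (at z)"
        using eventually_poly_nonzero[OF \<open>P1 * P2 \<noteq> 0\<close>]
      proof eventually_elim
        case (elim w)
        then have "poly P1 w \<noteq> 0" "poly P2 w \<noteq> 0" by auto
        then have "Gc w * Gp w = poly (Q1 * Q2) w / poly (P1 * P2) w * (exp (- of_real t1 * w) * exp (- of_real t2 * w))"
          using 1(3) 2(3) by simp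
        also have "exp (- of_real t1 * w) * exp (- of_real t2 * w) = exp (- of_real (t1 + t2) * w)"
          by (simp add: algebra_simps flip: exp_add)
        finally show ?case using PQ(3)[OF elim] by metis
      qed
    qed
  qed (use 1 2 PQ in auto)
qed

lemma rhp_zeros_subset:
  assumes "rhp_zeros f as"
  shows "set as \<subseteq> rhp"
  using assms unfolding rhp_zeros_def by (metis count_list_0_iff subsetI)

lemma rhp_poles_subset:
  assumes "rhp_poles f as"
  shows "set as \<subseteq> rhp"
  using assms unfolding rhp_poles_def by (metis count_list_0_iff subsetI)

section \<open>Subtracting the formulas for numerator and denominator of the sensitivity\<close>

theorem theorem1:
  fixes Gc Gp G g :: "complex \<Rightarrow> complex"
    and \<alpha>s \<beta>s :: "complex list"
  assumes "transfer_function Gc" and "transfer_function Gp"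
    and "G = open_loop Gc Gp"
    and "\<exists>s. 1 + G s \<noteq> 0"
    and "g = sensitivity G"
    and "\<not> g analytic_on rhp"
    and "rhp_zeros g \<alpha>s"
    and "rhp_poles g \<beta>s"
  shows "(\<forall>\<sigma> \<eta> :: real. \<sigma> > 0 \<and> \<not> isolated_zero g (Complex \<sigma> \<eta>) \<and> \<not> is_pole g (Complex \<sigma> \<eta>) \<longrightarrow>
           has_bochner_integral lborel
             (\<lambda>\<omega>::real. ln (cmod (g (\<i> * of_real \<omega>))) * (\<sigma> / (\<sigma>\<^sup>2 + (\<omega> - \<eta>)\<^sup>2)))
             (- pi * (- ln (cmod (g (Complex \<sigma> \<eta>)))
                      + (\<Sum>\<alpha>\<leftarrow>\<alpha>s. ln (cmod ((Complex \<sigma> \<eta> - \<alpha>) / (Complex \<sigma> \<eta> + cnj \<alpha>))))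
                      + (\<Sum>\<beta>\<leftarrow>\<beta>s. ln (cmod ((Complex \<sigma> \<eta> + cnj \<beta>) / (Complex \<sigma> \<eta> - \<beta>))))))) \<and>
         (\<forall>\<sigma> \<eta> :: real. \<sigma> > 0 \<and> isolated_zero G (Complex \<sigma> \<eta>) \<longrightarrow>
           has_bochner_integral lborel
             (\<lambda>\<omega>::real. ln (cmod (g (\<i> * of_real \<omega>))) * (\<sigma> / (\<sigma>\<^sup>2 + (\<omega> - \<eta>)\<^sup>2)))
             (- pi * ((\<Sum>\<alpha>\<leftarrow>\<alpha>s. ln (cmod ((Complex \<sigma> \<eta> - \<alpha>) / (Complex \<sigma> \<eta> + cnj \<alpha>))))
                      + (\<Sum>\<beta>\<leftarrow>\<beta>s. ln (cmod ((Complex \<sigma> \<eta> + cnj \<beta>) / (Complex \<sigma> \<eta> - \<beta>)))))))"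
proof -
  obtain P Q :: "complex poly" and t :: real where P: "P \<noteq> 0" and t: "t \<ge> 0"
    and coprime: "\<And>s. \<not> (poly P s = 0 \<and> poly Q s = 0)"
    and "open_loop Gc Gp = remove_sings (\<lambda>s. poly Q s / poly P s * exp (- of_real t * s))"
    using assms(1,2) by (rule open_loop_eq_quotient) (rule that)
  with assms(3) have G: "G = remove_sings (\<lambda>s. poly Q s / poly P s * exp (- of_real t * s))" by simp
  define F where "F s = poly P s + poly Q s * exp (- of_real t * s)" for s
  define R where "R s = poly P s / F s" for s
  have Fhol: "F holomorphic_on UNIV" unfolding F_def by (intro holomorphic_intros)
  have Phol: "poly P holomorphic_on UNIV" by (intro holomorphic_intros)
  obtain p0 where p0: "poly P p0 \<noteq> 0" using P poly_all_0_iff_0 by blast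
  have G_eq: "1 + G s = F s / poly P s" if "poly P s \<noteq> 0" for s
  proof -
    have "G s = poly Q s / poly P s * exp (- of_real t * s)"
      unfolding G using that by (intro remove_sings_at_analytic analytic_intros) auto
    then show ?thesis using that by (simp add: F_def field_simps)
  qed
  \<comment> \<open>Otherwise \<open>G\<close> would be -1 off the roots of \<open>P\<close>, and
    \<open>remove_sings\<close> would extend this to every point.\<close>
  have "\<exists>z. F z \<noteq> 0"
  proof (rule ccontr)
    assume F0: "\<not> (\<exists>z. F z \<noteq> 0)"
    have "G s = - 1" for s
    proof -
      have "eventually (\<lambda>w. poly Q w / poly P w * exp (- of_real t * w) = - 1) (at s)"
        using eventually_poly_nonzero[OF P]
      proof eventually_elim
        case (elim w)
        have "poly P w + poly Q w * exp (- of_real t * w) = 0" using F0 by (simp add: F_def)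
        then have "poly Q w * exp (- of_real t * w) = - poly P w" by (simp add: add_eq_0_iff)
        then show ?case using elim by simp
      qed
      then show ?thesis unfolding G by (intro remove_sings_eqI tendsto_eventually)
    qed
    then show False using assms(4) by simp
  qed
  then obtain z0 where z0: "F z0 \<noteq> 0" by blast
  note Pnz = entire_zorder_eventually_nonzero[OF Phol p0]
  note Fnz = entire_zorder_eventually_nonzero[OF Fhol z0]
  have ev: "eventually (\<lambda>w. 1 / (1 + G w) = R w) (at s)" for s
    using Pnz(2) by eventually_elim (simp add: G_eq R_def)
  have g: "g = remove_sings R"
    unfolding assms(5) sensitivity_def by (rule ext, rule remove_sings_cong[OF ev refl])
  have Rmero: "R meromorphic_on {s}" for s
    unfolding R_def by (intro meromorphic_intros analytic_on_imp_meromorphic_on Pnz Fnz)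
  then have Riso: "isolated_singularity_at R s" for s by (simp add: meromorphic_at_iff)
  have Rnz: "eventually (\<lambda>w. R w \<noteq> 0) (at s)" for s
    using Pnz(2) Fnz(2) by eventually_elim (simp add: R_def)
  have ord: "zorder g s = zorder (poly P) s - zorder F s" for s
  proof -
    have "zorder g s = zorder R s" unfolding g by (simp add: Riso)
    also have "\<dots> = zorder (poly P) s - zorder F s" unfolding R_def
      by (intro zorder_divide analytic_on_imp_meromorphic_on Pnz Fnz eventually_frequently at_neq_bot)
    finally show ?thesis .
  qed
  have ord0: "zorder (poly P) s \<ge> 0" "zorder F s \<ge> 0" "zorder (poly P) s = 0 \<longleftrightarrow> poly P s \<noteq> 0"
    "zorder F s = 0 \<longleftrightarrow> F s \<noteq> 0" for s
    by (intro zorder_ge_0 zorder_eq_0_iff Pnz Fnz eventually_frequently at_neq_bot)+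
  \<comment> \<open>A common zero of \<open>P\<close> and \<open>F\<close> would be a zero of
    \<open>Q\<close> as well. So nothing cancels in \<open>P / F\<close>: zeros and poles of
    \<open>g\<close> are the zeros of \<open>P\<close> and of \<open>F\<close>, with the same
    multiplicities.\<close>
  have ord1: "zorder (poly P) s = 0 \<or> zorder F s = 0" for s
    unfolding ord0 using coprime[of s] by (auto simp: F_def)
  have zero_iff: "isolated_zero g s \<longleftrightarrow> zorder g s > 0" for s
    unfolding g using zorder_pos_imp_isolated_zero[OF Rmero Rnz, of s] zorder_isolated_zero_pos'[OF _ Riso, of s]
    by (auto simp: Riso)
  have pole_iff: "is_pole g s \<longleftrightarrow> zorder g s < 0" for s
    unfolding g using zorder_neg_imp_is_pole[OF Rmero Rnz, of s] isolated_pole_imp_neg_zorder[OF Riso, of s]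
    by (auto simp: Riso is_pole_remove_sings_iff)
  have count_\<alpha>: "int (count_list \<alpha>s s) = zorder (poly P) s" if "s \<in> rhp" for s
    using assms(7) that ord[of s] ord0[of s] ord1[of s] unfolding rhp_zeros_def zero_iff by auto
  have count_\<beta>: "int (count_list \<beta>s s) = zorder F s" if "s \<in> rhp" for s
    using assms(8) that ord[of s] ord0[of s] ord1[of s] unfolding rhp_poles_def pole_iff by auto
  have main: "has_bochner_integral lborel
             (\<lambda>\<omega>::real. ln (cmod (g (\<i> * of_real \<omega>))) * (\<sigma> / (\<sigma>\<^sup>2 + (\<omega> - \<eta>)\<^sup>2)))
             (- pi * (- ln (cmod (g (Complex \<sigma> \<eta>)))
                      + (\<Sum>\<alpha>\<leftarrow>\<alpha>s. ln (cmod ((Complex \<sigma> \<eta> - \<alpha>) / (Complex \<sigma> \<eta> + cnj \<alpha>))))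
                      + (\<Sum>\<beta>\<leftarrow>\<beta>s. ln (cmod ((Complex \<sigma> \<eta> + cnj \<beta>) / (Complex \<sigma> \<eta> - \<beta>))))))"
    if \<sigma>: "\<sigma> > 0" and nz: "\<not> isolated_zero g (Complex \<sigma> \<eta>)" "\<not> is_pole g (Complex \<sigma> \<eta>)" for \<sigma> \<eta> :: real
  proof -
    let ?z = "Complex \<sigma> \<eta>" and ?p = "\<lambda>\<omega>. \<sigma> / (\<sigma>\<^sup>2 + (\<omega> - \<eta>)\<^sup>2)"
    have z: "poly P ?z \<noteq> 0" "F ?z \<noteq> 0"
      using nz ord[of ?z] ord0[of ?z] ord1[of ?z] unfolding zero_iff pole_iff by auto
    have gR: "g s = R s" if "F s \<noteq> 0" for s
      unfolding g R_def using that by (intro remove_sings_at_analytic analytic_intros Pnz Fnz) auto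
    obtain c where c: "c > 0" "eventually (\<lambda>x. c \<le> cmod (poly P (Complex x \<eta>))) at_top"
      using poly_lower_bound_ray[OF P] by blast
    obtain d where d: "d > 0" "eventually (\<lambda>x. d \<le> cmod (F (Complex x \<eta>))) at_top"
      by (rule exp_poly_lower_bound_ray[OF t P z0[unfolded F_def], of \<eta>, folded F_def]) (rule that)
    obtain K where K: "\<And>s n. \<lbrakk>Re s \<ge> 0; degree P \<le> n\<rbrakk> \<Longrightarrow> cmod (poly P s) \<le> K * cmod (1 + s) ^ n"
      using polynomial_growth_rhp by metis
    obtain L n where L: "\<And>s. Re s \<ge> 0 \<Longrightarrow> cmod (F s) \<le> L * cmod (1 + s) ^ n"
      by (rule exp_poly_growth_rhp[OF t, of P Q, folded F_def]) (rule that, blast)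
    have "has_bochner_integral lborel
        (\<lambda>\<omega>. ln (cmod (poly P (\<i> * of_real \<omega>))) * ?p \<omega> - ln (cmod (F (\<i> * of_real \<omega>))) * ?p \<omega>)
        (pi * (ln (cmod (poly P ?z)) - (\<Sum>a\<leftarrow>\<alpha>s. ln (cmod ((?z - a) / (?z + cnj a))))) -
         pi * (ln (cmod (F ?z)) - (\<Sum>a\<leftarrow>\<beta>s. ln (cmod ((?z - a) / (?z + cnj a))))))"
      by (intro has_bochner_integral_diff poisson_half_plane_zeros[OF Phol K[OF _ order_refl] c \<sigma> z(1) rhp_zeros_subset[OF assms(7)] count_\<alpha>]
          poisson_half_plane_zeros[OF Fhol L d \<sigma> z(2) rhp_poles_subset[OF assms(8)] count_\<beta>])
    also have "(\<Sum>a\<leftarrow>\<beta>s. ln (cmod ((?z - a) / (?z + cnj a)))) = - (\<Sum>a\<leftarrow>\<beta>s. ln (cmod ((?z + cnj a) / (?z - a))))"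
      by (induction \<beta>s) (simp_all add: norm_divide ln_div)
    also have "pi * (ln (cmod (poly P ?z)) - (\<Sum>a\<leftarrow>\<alpha>s. ln (cmod ((?z - a) / (?z + cnj a))))) -
         pi * (ln (cmod (F ?z)) - - (\<Sum>a\<leftarrow>\<beta>s. ln (cmod ((?z + cnj a) / (?z - a))))) =
         - pi * (- ln (cmod (g ?z))
                      + (\<Sum>\<alpha>\<leftarrow>\<alpha>s. ln (cmod ((?z - \<alpha>) / (?z + cnj \<alpha>))))
                      + (\<Sum>\<beta>\<leftarrow>\<beta>s. ln (cmod ((?z + cnj \<beta>) / (?z - \<beta>)))))"
      using z by (simp add: gR R_def norm_divide ln_div) (simp add: algebra_simps)
    finally have *: "has_bochner_integral lborel
        (\<lambda>\<omega>. ln (cmod (poly P (\<i> * of_real \<omega>))) * ?p \<omega> - ln (cmod (F (\<i> * of_real \<omega>))) * ?p \<omega>)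
        (- pi * (- ln (cmod (g ?z))
                      + (\<Sum>\<alpha>\<leftarrow>\<alpha>s. ln (cmod ((?z - \<alpha>) / (?z + cnj \<alpha>))))
                      + (\<Sum>\<beta>\<leftarrow>\<beta>s. ln (cmod ((?z + cnj \<beta>) / (?z - \<beta>))))))" .
    \<comment> \<open>Off these points \<open>ln |g| = ln |P| - ln |F|\<close>; on them the default
      values at poles and of \<open>ln 0\<close> may break the identity.\<close>
    have X: "countable ({\<omega>. poly P (\<i> * of_real \<omega>) = 0} \<union> {\<omega>. F (\<i> * of_real \<omega>) = 0})"
      using countable_imaginary_axis_zeros[OF Phol p0] countable_imaginary_axis_zeros[OF Fhol z0] by simp
    show ?thesis
      using * by (rule has_bochner_integral_discrete_difference[OF X, THEN iffD1, rotated 3])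
        (auto simp: gR R_def norm_divide ln_div algebra_simps diff_divide_distrib)
  qed
  have "has_bochner_integral lborel
             (\<lambda>\<omega>::real. ln (cmod (g (\<i> * of_real \<omega>))) * (\<sigma> / (\<sigma>\<^sup>2 + (\<omega> - \<eta>)\<^sup>2)))
             (- pi * ((\<Sum>\<alpha>\<leftarrow>\<alpha>s. ln (cmod ((Complex \<sigma> \<eta> - \<alpha>) / (Complex \<sigma> \<eta> + cnj \<alpha>))))
                      + (\<Sum>\<beta>\<leftarrow>\<beta>s. ln (cmod ((Complex \<sigma> \<eta> + cnj \<beta>) / (Complex \<sigma> \<eta> - \<beta>))))))"
    if \<sigma>: "\<sigma> > 0" and zero: "isolated_zero G (Complex \<sigma> \<eta>)" for \<sigma> \<eta> :: real
  proof -
    let ?z = "Complex \<sigma> \<eta>"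
    \<comment> \<open>At a zero of \<open>G\<close> the sensitivity has limit 1, hence value 1: the
      point is neither a zero nor a pole of \<open>g\<close>, and the term \<open>ln |g|\<close> in
      \<open>main\<close> vanishes.\<close>
    have "((\<lambda>w. 1 / (1 + G w)) \<longlongrightarrow> 1 / (1 + 0)) (at ?z)"
      using zero unfolding isolated_zero_def by (intro tendsto_intros) auto
    then have "(R \<longlongrightarrow> 1) (at ?z)" using ev[of ?z] by (simp add: filterlim_cong)
    then have "g ?z = 1" "\<not> isolated_zero g ?z" "\<not> is_pole g ?z"
      unfolding g using LIM_unique[of R 1 ?z 0] not_tendsto_and_filterlim_at_infinity[of "at ?z" R 1]
      by (auto simp: Riso isolated_zero_def is_pole_def[of R] is_pole_remove_sings_iff)
    then show ?thesis using main[OF \<sigma>, of \<eta>] by simp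
  qed
  with main show ?thesis by blast
qed

end
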